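(* Let assumption (A) of the context hold and let $N_k=\lceil(k+1)^v\rceil$ for some $v>0$. Consider the variance-reduced SGD algorithm $$x_{k+1}=x_k-\alpha\,(\nabla f(x_k)+w_{k,N_k}),\qquad k\ge 0,$$ with $\alpha\in(0,\tfrac2{\eta+L}]$. Define $q=1-\tfrac{2\alpha\eta L}{\eta+L}$ and $c_{q,v}=e^{-v}\big(\tfrac{v}{\ln(1/q)}\big)^v$. Then for all $k\ge1$ $$\mathbb E[\|x_k-x^*\|^2]\le C_v\,k^{-v},\qquad C_v=c_{q,v}\,\mathbb E[\|x_0-x^*\|^2]+\frac{\alpha^2\nu^2c_{q,v}(e^{2v}q^{-1}-1)}{1-q}+\frac{2\alpha^2\nu^2}{q\ln(1/q)}.$$ Then the number of iterations and the number of sampled gradients required to obtain an $\epsilon$-optimal solution in the mean-squared sense (i.e. $\mathbb E[\|x-x^*\|^2]\le\epsilon$) are $\mathcal O\big(v(1/\epsilon)^{1/v}\big)$ and $\mathcal O\big(e^vv^v(1/\epsilon)^{1+1/v}\big)$, respectively.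
   Context: Problem: minimize $f(x)=\mathbb E[F(x,\boldsymbol\xi)]$ over $x\in\mathbb R^m$, where $\boldsymbol\xi$ is an $\mathbb R^d$-valued random vector and $F:\mathbb R^m\times\mathbb R^d\to\mathbb R$. Sampled gradients $\nabla F(x,\xi)$ (gradient in $x$) are available. Given $x_0\in\mathbb R^m$ and positive integers $N_k$ (batch sizes), $\xi_{j,k}$ ($1\le j\le N_k$, $k\ge 0$) are i.i.d. copies of $\boldsymbol\xi$; $w_{k,N_k}=\frac1{N_k}\sum_{j=1}^{N_k}\nabla F(x_k,\xi_{j,k})-\nabla f(x_k)$; and $\mathcal F_k=\sigma\{x_0,\xi_{j,t}:1\le j\le N_t,\,0\le t\le k-1\}$, so $x_k$ is $\mathcal F_k$-measurable. Assumption (A): (i) $f$ is continuously differentiable on $\mathbb R^m$ and $\|\nabla f(x)-\nabla f(x')\|\le L\|x-x'\|$ for all $x,x'$, with $L>0$; (ii) $f$ is $\eta$-strongly convex, $\eta>0$: $(\nabla f(x)-\nabla f(x'))^T(x-x')\ge\eta\|x-x'\|^2$ for all $x,x'$; (iii) there is $\nu>0$ such that for all $k\ge0$ and $1\le j\le N_k$, almost surely $\mathbb E[\nabla F(x_k,\xi_{j,k})\mid\mathcal F_k]=\nabla f(x_k)$ and $\mathbb E[\|\nabla F(x_k,\xi_{j,k})-\nabla f(x_k)\|^2\mid\mathcal F_k]\le\nu^2$. The unique minimizer of $f$ is denoted $x^*$. If $K$ iterations are performed, the number of sampled gradients used is $\sum_{k=0}^{K-1}N_k$.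
   Formalization: The explicit bound with C_v is stated only for q > 0: when L = η and α = 1/L one has q = 0, and ln(1/q) and 1/q in C_v are undefined; the complexity claims, read as ε → 0, are stated for all α, including q = 0. *)

theory Defs
  imports "HOL-Probability.Probability"
begin

definition gradient :: "('a::real_inner \<Rightarrow> real) \<Rightarrow> 'a \<Rightarrow> 'a" where
  "gradient g x = (THE D. GDERIV g x :> D)"

text \<open>
  A sample array \<open>\<Xi>\<close> is used as \<open>\<Xi> j k\<close>: the \<open>j\<close>-th sample of iteration \<open>k\<close>, for \<open>1 \<le> j \<le> N k\<close>.
\<close>

definition batch_size :: "real \<Rightarrow> nat \<Rightarrow> nat" where
  "batch_size v k = nat \<lceil>(real k + 1) powr v\<rceil>"

definition sample_index :: "(nat \<Rightarrow> nat) \<Rightarrow> (nat \<times> nat) set" where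
  "sample_index N = {(j, k). 1 \<le> j \<and> j \<le> N k}"

definition sampling_error ::
  "(real^'m \<Rightarrow> real) \<Rightarrow> (real^'m \<Rightarrow> real^'d \<Rightarrow> real) \<Rightarrow> (nat \<Rightarrow> nat) \<Rightarrow> (nat \<Rightarrow> nat \<Rightarrow> 'w \<Rightarrow> real^'d)
    \<Rightarrow> nat \<Rightarrow> real^'m \<Rightarrow> 'w \<Rightarrow> real^'m" where
  "sampling_error f F N \<Xi> k x \<omega> =
     (1 / real (N k)) *\<^sub>R (\<Sum>j=1..N k. gradient (\<lambda>y. F y (\<Xi> j k \<omega>)) x) - gradient f x"

primrec sgd ::
  "(real^'m \<Rightarrow> real) \<Rightarrow> (real^'m \<Rightarrow> real^'d \<Rightarrow> real) \<Rightarrow> real \<Rightarrow> (nat \<Rightarrow> nat) \<Rightarrow> (nat \<Rightarrow> nat \<Rightarrow> 'w \<Rightarrow> real^'d)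
    \<Rightarrow> ('w \<Rightarrow> real^'m) \<Rightarrow> nat \<Rightarrow> 'w \<Rightarrow> real^'m" where
  "sgd f F \<alpha> N \<Xi> x0 0 \<omega> = x0 \<omega>"
| "sgd f F \<alpha> N \<Xi> x0 (Suc k) \<omega> =
     sgd f F \<alpha> N \<Xi> x0 k \<omega> - \<alpha> *\<^sub>R (gradient f (sgd f F \<alpha> N \<Xi> x0 k \<omega>)
        + sampling_error f F N \<Xi> k (sgd f F \<alpha> N \<Xi> x0 k \<omega>) \<omega>)"

text \<open>
  The samples are independent copies of \<open>\<xi>\<close>, and jointly independent of the initial point
  (no condition if \<open>x0\<close> is constant).
\<close>

definition iid_samples ::
  "'w measure \<Rightarrow> ('w \<Rightarrow> real^'d) \<Rightarrow> ('w \<Rightarrow> real^'m) \<Rightarrow> (nat \<Rightarrow> nat) \<Rightarrow> (nat \<Rightarrow> nat \<Rightarrow> 'w \<Rightarrow> real^'d) \<Rightarrow> bool"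
where
  "iid_samples M \<xi> x0 N \<Xi> \<longleftrightarrow>
     prob_space.indep_vars M (\<lambda>_. borel) (\<lambda>(j, k). \<Xi> j k) (sample_index N) \<and>
     (\<forall>(j, k)\<in>sample_index N. distr M borel (\<Xi> j k) = distr M borel \<xi>) \<and>
     prob_space.indep_set M
       {x0 -` A \<inter> space M | A. A \<in> sets borel}
       {(\<lambda>\<omega>. \<lambda>(j, k)\<in>sample_index N. \<Xi> j k \<omega>) -` A \<inter> space M | A.
          A \<in> sets (PiM (sample_index N) (\<lambda>_. borel))}"

text \<open>
  The sigma-algebra generated by \<open>x0\<close> and the samples of the iterations before \<open>k\<close>. Conditional
  expectations with respect to a measure only depend on its sets.
\<close>

definition history ::
  "'w measure \<Rightarrow> ('w \<Rightarrow> real^'m) \<Rightarrow> (nat \<Rightarrow> nat) \<Rightarrow> (nat \<Rightarrow> nat \<Rightarrow> 'w \<Rightarrow> real^'d) \<Rightarrow> nat \<Rightarrow> 'w measure"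
where
  "history M x0 N \<Xi> k = sigma (space M)
     ({x0 -` A \<inter> space M | A. A \<in> sets borel} \<union>
      {\<Xi> j t -` A \<inter> space M | j t A. (j, t) \<in> sample_index N \<and> t < k \<and> A \<in> sets borel})"

definition vec_cond_exp :: "'w measure \<Rightarrow> 'w measure \<Rightarrow> ('w \<Rightarrow> real^'m) \<Rightarrow> 'w \<Rightarrow> real^'m" where
  "vec_cond_exp M G X \<omega> = (\<chi> i. real_cond_exp M G (\<lambda>\<omega>'. X \<omega>' $ i) \<omega>)"

text \<open>
  The second moment is taken in \<open>ennreal\<close>: for a function that is not integrable,
  \<open>real_cond_exp\<close> could be \<open>0\<close>, and a bound on it would say nothing.
\<close>

definition unbiased_bounded_variance ::
  "'w measure \<Rightarrow> (real^'m \<Rightarrow> real) \<Rightarrow> (real^'m \<Rightarrow> real^'d \<Rightarrow> real) \<Rightarrow> real \<Rightarrow> real \<Rightarrow> (nat \<Rightarrow> nat)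
    \<Rightarrow> (nat \<Rightarrow> nat \<Rightarrow> 'w \<Rightarrow> real^'d) \<Rightarrow> ('w \<Rightarrow> real^'m) \<Rightarrow> bool"
where
  "unbiased_bounded_variance M f F \<nu> \<alpha> N \<Xi> x0 \<longleftrightarrow>
     (\<forall>(j, k)\<in>sample_index N.
       (AE \<omega> in M. vec_cond_exp M (history M x0 N \<Xi> k)
            (\<lambda>\<omega>. gradient (\<lambda>y. F y (\<Xi> j k \<omega>)) (sgd f F \<alpha> N \<Xi> x0 k \<omega>)) \<omega>
          = gradient f (sgd f F \<alpha> N \<Xi> x0 k \<omega>)) \<and>
       (AE \<omega> in M. nn_cond_exp M (history M x0 N \<Xi> k)
            (\<lambda>\<omega>. ennreal ((norm (gradient (\<lambda>y. F y (\<Xi> j k \<omega>)) (sgd f F \<alpha> N \<Xi> x0 k \<omega>)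
                                - gradient f (sgd f F \<alpha> N \<Xi> x0 k \<omega>)))\<^sup>2)) \<omega>
          \<le> ennreal (\<nu>\<^sup>2)))"

definition mean_sq_error :: "'w measure \<Rightarrow> real^'m \<Rightarrow> (nat \<Rightarrow> 'w \<Rightarrow> real^'m) \<Rightarrow> nat \<Rightarrow> real" where
  "mean_sq_error M xs x k = (\<integral>\<omega>. (norm (x k \<omega> - xs))\<^sup>2 \<partial>M)"

definition iterations_required :: "'w measure \<Rightarrow> real^'m \<Rightarrow> (nat \<Rightarrow> 'w \<Rightarrow> real^'m) \<Rightarrow> real \<Rightarrow> nat" where
  "iterations_required M xs x \<epsilon> = (LEAST K. mean_sq_error M xs x K \<le> \<epsilon>)"

definition gradients_required ::
  "'w measure \<Rightarrow> real^'m \<Rightarrow> (nat \<Rightarrow> 'w \<Rightarrow> real^'m) \<Rightarrow> (nat \<Rightarrow> nat) \<Rightarrow> real \<Rightarrow> nat" where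
  "gradients_required M xs x N \<epsilon> = (\<Sum>k<iterations_required M xs x \<epsilon>. N k)"

definition c_const :: "real \<Rightarrow> real \<Rightarrow> real" where
  "c_const q v = exp (- v) * (v / ln (1 / q)) powr v"

definition C_const :: "real \<Rightarrow> real \<Rightarrow> real \<Rightarrow> real \<Rightarrow> real \<Rightarrow> real" where
  "C_const q \<alpha> \<nu> e0 v =
     c_const q v * e0
     + \<alpha>\<^sup>2 * \<nu>\<^sup>2 * c_const q v * (exp (2 * v) * inverse q - 1) / (1 - q)
     + 2 * \<alpha>\<^sup>2 * \<nu>\<^sup>2 / (q * ln (1 / q))"

end

theory Submission
  imports Defs "HOL-Real_Asymp.Real_Asymp"
begin

text \<open>
  Co-coercivity of the gradient makes a full gradient step a contraction with factor \<open>q\<close> of the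
  squared distance to the minimizer. Given the history, the samples of a batch are independent, so
  the averaged noise is orthogonal to that step and the noise terms are orthogonal to each other;
  hence the mean squared errors satisfy \<open>e (k + 1) \<le> q * e k + \<alpha>\<^sup>2 * \<nu>\<^sup>2 / N k\<close>. Unrolling gives the
  convolution of \<open>q ^ k\<close> with \<open>k powr (- v)\<close>, which is \<open>O(k powr (- v))\<close>.
\<close>

text \<open>The unbiasedness assumption conditions on the history alone, whereas orthogonality of
  two noise terms of one batch needs mean zero given the history and the other sample. Independence
  closes the gap. A fresh sample is independent of all the others, so the mean of its noise given
  them is h(\<open>iterate k\<close>) for a single function h. The assumption forces h to vanish
  almost everywhere under the law of the iterate. Hence a noise term is orthogonal to every
  square-integrable vector built from the history and other samples.

  Two facts shape the scalar part. If \<eta> = L and \<alpha> is maximal, then q = 0 and the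
  constant with \<open>ln (1 / q)\<close> degenerates; the bound with \<open>C_const\<close> is
  therefore restricted to q > 0, while the complexity bounds take a route that includes q = 0.
  Moreover, those bounds are to be uniform in v: terms carrying \<open>q ^ k\<close> have constants
  that grow with v, but they are transient and disappear for small \<epsilon>, which leaves a
  constant free of v.\<close>

section \<open>Gradients of smooth, strongly convex functions\<close>

lemma GDERIV_gradient:
  fixes g :: "'a::euclidean_space \<Rightarrow> real"
  assumes "g differentiable (at x)"
  shows "GDERIV g x :> gradient g x"
proof -
  obtain g' where g': "(g has_derivative g') (at x)"
    using assms by (auto simp: differentiable_def)
  then have lin: "linear g'"
    by (rule has_derivative_linear)
  define D where "D = adjoint g' (1::real)"
  have "g' = (\<lambda>h. h \<bullet> D)"
    using adjoint_works[OF lin, of _ "1::real"] by (simp add: D_def fun_eq_iff)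
  with g' have D: "GDERIV g x :> D"
    by (simp add: gderiv_def)
  \<comment> \<open>Existence alone is not enough: \<open>gradient\<close> is a definite
    description, so the representing vector must also be unique.\<close>
  have "D' = D" if "GDERIV g x :> D'" for D'
  proof -
    have "(\<lambda>h. h \<bullet> D') = (\<lambda>h. h \<bullet> D)"
      using that D unfolding gderiv_def by (rule has_derivative_unique)
    then show ?thesis
      by (metis inner_commute vector_eq_rdot)
  qed
  with D show ?thesis
    unfolding gradient_def by (metis theI)
qed

lemma has_real_derivative_along_segment:
  fixes f :: "'a::euclidean_space \<Rightarrow> real"
  assumes "\<And>x. f differentiable (at x)"
  shows "((\<lambda>t. f (x + t *\<^sub>R d)) has_real_derivative (gradient f (x + t *\<^sub>R d) \<bullet> d)) (at t)"
proof -
  have "(f has_derivative (\<lambda>h. h \<bullet> gradient f (x + t *\<^sub>R d))) (at (x + t *\<^sub>R d))"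
    using GDERIV_gradient[OF assms] by (simp add: gderiv_def)
  moreover have "((\<lambda>t. x + t *\<^sub>R d) has_derivative (\<lambda>s. s *\<^sub>R d)) (at t)"
    by (auto intro!: derivative_eq_intros)
  ultimately have "((\<lambda>t. f (x + t *\<^sub>R d)) has_derivative (\<lambda>s. (s *\<^sub>R d) \<bullet> gradient f (x + t *\<^sub>R d))) (at t)"
    by (rule has_derivative_compose[rotated])
  then show ?thesis
    unfolding has_field_derivative_def
    by (rule has_derivative_eq_rhs) (auto simp: fun_eq_iff inner_commute)
qed

text \<open>Descent lemma. Once the quadratic model is subtracted along the segment, the derivative
  in t is the gradient increment paired with d minus \<open>L * t * (norm d)\<^sup>2\<close>, which
  is nonpositive by Cauchy-Schwarz and the Lipschitz bound.\<close>

lemma gradient_quadratic_upper_bound: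
  fixes f :: "'a::euclidean_space \<Rightarrow> real"
  assumes diff: "\<And>x. f differentiable (at x)"
    and lip: "\<And>x y. norm (gradient f x - gradient f y) \<le> L * norm (x - y)"
  shows "f (x + d) \<le> f x + gradient f x \<bullet> d + L / 2 * (norm d)\<^sup>2"
proof -
  define h where "h t = f (x + t *\<^sub>R d) - t * (gradient f x \<bullet> d) - L / 2 * t\<^sup>2 * (norm d)\<^sup>2" for t
  have "h 1 \<le> h 0"
  proof (rule DERIV_nonpos_imp_nonincreasing[of 0 1 h])
    fix t :: real assume t: "0 \<le> t" "t \<le> 1"
    have "(h has_real_derivative (gradient f (x + t *\<^sub>R d) - gradient f x) \<bullet> d - L * t * (norm d)\<^sup>2) (at t)"
      unfolding h_def
      by (auto intro!: derivative_eq_intros has_real_derivative_along_segment[OF diff] simp: algebra_simps)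
    moreover have "(gradient f (x + t *\<^sub>R d) - gradient f x) \<bullet> d \<le> L * t * (norm d)\<^sup>2"
    proof -
      have "(gradient f (x + t *\<^sub>R d) - gradient f x) \<bullet> d \<le> norm (gradient f (x + t *\<^sub>R d) - gradient f x) * norm d"
        by (rule norm_cauchy_schwarz)
      also have "\<dots> \<le> L * norm (t *\<^sub>R d) * norm d"
        using lip[of "x + t *\<^sub>R d" x] by (intro mult_right_mono) auto
      finally show ?thesis
        using t by (simp add: power2_eq_square)
    qed
    ultimately show "\<exists>y. (h has_real_derivative y) (at t) \<and> y \<le> 0"
      by force
  qed auto
  then show ?thesis
    by (simp add: h_def)
qed

lemma gradient_quadratic_lower_bound:
  fixes f :: "'a::euclidean_space \<Rightarrow> real"
  assumes diff: "\<And>x. f differentiable (at x)"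
    and mono: "\<And>x y. (gradient f x - gradient f y) \<bullet> (x - y) \<ge> \<eta> * (norm (x - y))\<^sup>2"
  shows "f (x + d) \<ge> f x + gradient f x \<bullet> d + \<eta> / 2 * (norm d)\<^sup>2"
proof -
  define h where "h t = f (x + t *\<^sub>R d) - t * (gradient f x \<bullet> d) - \<eta> / 2 * t\<^sup>2 * (norm d)\<^sup>2" for t
  have "h 0 \<le> h 1"
  proof (rule DERIV_nonneg_imp_nondecreasing[of 0 1 h])
    fix t :: real assume t: "0 \<le> t" "t \<le> 1"
    have "(h has_real_derivative (gradient f (x + t *\<^sub>R d) - gradient f x) \<bullet> d - \<eta> * t * (norm d)\<^sup>2) (at t)"
      unfolding h_def
      by (auto intro!: derivative_eq_intros has_real_derivative_along_segment[OF diff] simp: algebra_simps)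
    moreover have "(gradient f (x + t *\<^sub>R d) - gradient f x) \<bullet> d \<ge> \<eta> * t * (norm d)\<^sup>2"
    \<comment> \<open>Monotonicity is tested on the displacement \<open>t *\<^sub>R d\<close>, so it
      yields the desired inequality multiplied by t, and t must be cancelled.\<close>
    proof (cases "t = 0")
      case False
      with t have "0 < t" by simp
      have "\<eta> * t * (norm d)\<^sup>2 * t \<le> (gradient f (x + t *\<^sub>R d) - gradient f x) \<bullet> d * t"
        using mono[of "x + t *\<^sub>R d" x] by (simp add: power_mult_distrib power2_eq_square mult_ac)
      with \<open>0 < t\<close> show ?thesis by (rule mult_right_le_imp_le[rotated])
    qed simp
    ultimately show "\<exists>y. (h has_real_derivative y) (at t) \<and> y \<ge> 0"
      by force
  qed auto
  then show ?thesis
    by (simp add: h_def)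
qed

lemma gradient_at_minimizer:
  fixes f :: "'a::euclidean_space \<Rightarrow> real"
  assumes diff: "f differentiable (at xs)" and min: "\<And>y. f xs \<le> f y"
  shows "gradient f xs = 0"
proof -
  have "(\<lambda>h. h \<bullet> gradient f xs) = (\<lambda>h. 0)"
    using GDERIV_gradient[OF diff] min
    by (intro differential_zero_maxmin[of xs UNIV f]) (auto simp: gderiv_def)
  then show ?thesis
    by (metis inner_eq_zero_iff)
qed

text \<open>This is co-coercivity of the gradient of f minus \<eta>/2 times the squared norm, a
  convex function whose gradient has Lipschitz constant L - \<eta>, for the pair \<open>x\<close>,
  \<open>xs\<close>. The vector \<open>p\<close> is the increment of that gradient. Expanding
  \<open>(norm p)\<^sup>2 \<le> (L - \<eta>) * (p \<bullet> d)\<close> gives the claim.\<close>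

lemma gradient_coercive_at_minimizer:
  fixes f :: "'a::euclidean_space \<Rightarrow> real"
  assumes diff: "\<And>x. f differentiable (at x)"
    and lip: "\<And>x y. norm (gradient f x - gradient f y) \<le> L * norm (x - y)"
    and mono: "\<And>x y. (gradient f x - gradient f y) \<bullet> (x - y) \<ge> \<eta> * (norm (x - y))\<^sup>2"
    and min: "\<And>y. f xs \<le> f y"
  shows "(norm (gradient f x))\<^sup>2 + \<eta> * L * (norm (x - xs))\<^sup>2 \<le> (\<eta> + L) * (gradient f x \<bullet> (x - xs))"
proof -
  define g d p where "g = gradient f x" and "d = x - xs" and "p = g - \<eta> *\<^sub>R d"
  note grad0 = gradient_at_minimizer[OF diff min]
  have x: "x = xs + d"
    by (simp add: d_def)
  \<comment> \<open>The value of f at \<open>x - s\<close> is bounded below from \<open>xs\<close>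
    and above from \<open>x\<close>, and at \<open>xs + s\<close> the other way round. Adding the
    two chains cancels all values of f. The scale \<tau> stays free so that it can be optimized
    afterwards.\<close>
  have key: "2 * \<tau> * (norm p)\<^sup>2 - (L - \<eta>) * \<tau>\<^sup>2 * (norm p)\<^sup>2 \<le> p \<bullet> d" for \<tau>
  proof -
    define s where "s = \<tau> *\<^sub>R p"
    have "f xs + \<eta> / 2 * (norm (d - s))\<^sup>2 \<le> f (x - s)"
      using gradient_quadratic_lower_bound[OF diff mono, of xs "d - s"]
      by (simp add: grad0 x algebra_simps)
    also have "f (x - s) \<le> f x - g \<bullet> s + L / 2 * (norm s)\<^sup>2"
      using gradient_quadratic_upper_bound[OF diff lip, of x "- s"] by (simp add: g_def)
    finally have 1: "f xs + \<eta> / 2 * (norm (d - s))\<^sup>2 \<le> f x - g \<bullet> s + L / 2 * (norm s)\<^sup>2" .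
    have "f x + g \<bullet> (s - d) + \<eta> / 2 * (norm (s - d))\<^sup>2 \<le> f (xs + s)"
      using gradient_quadratic_lower_bound[OF diff mono, of x "s - d"]
      by (simp add: g_def x)
    also have "f (xs + s) \<le> f xs + L / 2 * (norm s)\<^sup>2"
      using gradient_quadratic_upper_bound[OF diff lip, of xs s] by (simp add: grad0)
    finally have 2: "f x + g \<bullet> (s - d) + \<eta> / 2 * (norm (s - d))\<^sup>2 \<le> f xs + L / 2 * (norm s)\<^sup>2" .
    have "2 * (p \<bullet> s) - (L - \<eta>) * (norm s)\<^sup>2 \<le> p \<bullet> d"
      using 1 2 unfolding p_def power2_norm_eq_inner
      by (simp add: inner_diff_left inner_diff_right inner_commute algebra_simps)
    moreover have "p \<bullet> s = \<tau> * (norm p)\<^sup>2" "(norm s)\<^sup>2 = \<tau>\<^sup>2 * (norm p)\<^sup>2"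
      by (simp_all add: s_def power2_norm_eq_inner power_mult_distrib)
    ultimately show ?thesis
      by (simp add: mult_ac)
  qed
  have "(norm p)\<^sup>2 \<le> (L - \<eta>) * (p \<bullet> d)"
  \<comment> \<open>A nonzero displacement is what yields \<eta> \<le> L, by comparing strong
    convexity with the Lipschitz bound along it.\<close>
  proof (cases "d = 0")
    case True
    with lip[of x xs] have "g = 0"
      by (simp add: g_def d_def grad0)
    with True show ?thesis
      by (simp add: p_def)
  next
    case False
    have "\<eta> * (norm d)\<^sup>2 \<le> g \<bullet> d"
      using mono[of x xs] by (simp add: g_def d_def grad0)
    also have "\<dots> \<le> norm g * norm d"
      by (rule norm_cauchy_schwarz)
    also have "\<dots> \<le> L * norm d * norm d"
      using lip[of x xs] by (intro mult_right_mono) (auto simp: g_def d_def grad0)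
    finally have "\<eta> * (norm d)\<^sup>2 \<le> L * (norm d)\<^sup>2"
      by (simp add: power2_eq_square mult_ac)
    with False have "\<eta> \<le> L"
      by simp
    show ?thesis
    proof (cases "\<eta> = L")
      case True
      have "(norm p)\<^sup>2 = 0"
      proof (rule ccontr)
        assume "(norm p)\<^sup>2 \<noteq> 0"
        \<comment> \<open>For \<eta> = L the quadratic term of \<open>key\<close> is absent and its
          left side is unbounded in \<tau> unless p = 0; this \<tau> makes it
          \<open>p \<bullet> d + 1\<close>.\<close>
        with key[of "(p \<bullet> d + 1) / (2 * (norm p)\<^sup>2)"] True show False
          by simp
      qed
      with True show ?thesis
        by simp
    next
      case False
      with \<open>\<eta> \<le> L\<close> have "L - \<eta> > 0"
        by simp
      \<comment> \<open>This \<tau> maximizes the left side of \<open>key\<close>.\<close>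
      with key[of "1 / (L - \<eta>)"] have "(norm p)\<^sup>2 / (L - \<eta>) \<le> p \<bullet> d"
        by (simp add: power2_eq_square)
      with \<open>L - \<eta> > 0\<close> show ?thesis
        by (simp add: pos_divide_le_eq mult.commute)
    qed
  qed
  then have "(norm g)\<^sup>2 + \<eta> * L * (norm d)\<^sup>2 \<le> (\<eta> + L) * (g \<bullet> d)"
    unfolding p_def power2_norm_eq_inner
    by (simp add: inner_diff_left inner_diff_right inner_commute algebra_simps)
  then show ?thesis
    by (simp add: g_def d_def)
qed

lemma gradient_step_contraction:
  fixes f :: "'a::euclidean_space \<Rightarrow> real"
  assumes diff: "\<And>x. f differentiable (at x)"
    and lip: "\<And>x y. norm (gradient f x - gradient f y) \<le> L * norm (x - y)"
    and mono: "\<And>x y. (gradient f x - gradient f y) \<bullet> (x - y) \<ge> \<eta> * (norm (x - y))\<^sup>2"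
    and min: "\<And>y. f xs \<le> f y"
    and pos: "0 < \<eta>" "0 < L" and \<alpha>: "0 < \<alpha>" "\<alpha> \<le> 2 / (\<eta> + L)"
  shows "(norm (x - \<alpha> *\<^sub>R gradient f x - xs))\<^sup>2 \<le> (1 - 2 * \<alpha> * \<eta> * L / (\<eta> + L)) * (norm (x - xs))\<^sup>2"
proof -
  define g d where "g = gradient f x" and "d = x - xs"
  have co: "((norm g)\<^sup>2 + \<eta> * L * (norm d)\<^sup>2) / (\<eta> + L) \<le> g \<bullet> d"
    using gradient_coercive_at_minimizer[OF diff lip mono min, of x] pos
    by (simp add: g_def d_def pos_divide_le_eq mult.commute)
  have "x - \<alpha> *\<^sub>R g - xs = d - \<alpha> *\<^sub>R g"
    by (simp add: d_def)
  then have "(norm (x - \<alpha> *\<^sub>R g - xs))\<^sup>2 = (norm d)\<^sup>2 - 2 * \<alpha> * (g \<bullet> d) + \<alpha> * \<alpha> * (norm g)\<^sup>2"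
    unfolding power2_norm_eq_inner
    by (simp add: inner_diff_left inner_diff_right inner_commute algebra_simps)
  \<comment> \<open>Only one factor of \<alpha>^2 is replaced by its upper bound 2/(\<eta> + L):
    then the two terms in \<open>(norm g)\<^sup>2\<close> cancel exactly and the factor q
    remains.\<close>
  also have "\<dots> \<le> (norm d)\<^sup>2 - 2 * \<alpha> * (((norm g)\<^sup>2 + \<eta> * L * (norm d)\<^sup>2) / (\<eta> + L)) + \<alpha> * (2 / (\<eta> + L)) * (norm g)\<^sup>2"
    using co \<alpha> by (intro add_mono diff_mono mult_left_mono mult_right_mono) auto
  also have "\<dots> = (1 - 2 * \<alpha> * \<eta> * L / (\<eta> + L)) * (norm d)\<^sup>2"
    by (simp add: algebra_simps add_divide_distrib)
  finally show ?thesis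
    by (simp add: g_def d_def)
qed

text \<open>A definite description carries no measurability of its own. Each coordinate is instead a
  pointwise limit of difference quotients of F along a basis vector, with steps 1/(n+1), and these
  are jointly measurable.\<close>

lemma borel_measurable_gradient:
  fixes F :: "'a::euclidean_space \<Rightarrow> 'b::second_countable_topology \<Rightarrow> real"
  assumes F[measurable]: "case_prod F \<in> borel_measurable (borel \<Otimes>\<^sub>M borel)"
    and diff: "\<And>x z. (\<lambda>y. F y z) differentiable (at x)"
  shows "(\<lambda>(x, z). gradient (\<lambda>y. F y z) x) \<in> borel_measurable (borel \<Otimes>\<^sub>M borel)"
proof (subst borel_measurable_euclidean_space, intro ballI)
  fix b :: 'a assume "b \<in> Basis"
  have "(\<lambda>n. (F (x + (1 / real (Suc n)) *\<^sub>R b) z - F x z) * real (Suc n)) \<longlonglongrightarrow> gradient (\<lambda>y. F y z) x \<bullet> b" for x z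
  proof -
    have "((\<lambda>t. (F (x + t *\<^sub>R b) z - F x z) / t) \<longlongrightarrow> gradient (\<lambda>y. F y z) x \<bullet> b) (at 0)"
      using has_real_derivative_along_segment[OF diff, where x = x and d = b and t = 0] by (simp add: DERIV_def)
    moreover have "filterlim (\<lambda>n. 1 / real (Suc n)) (at 0) sequentially"
      unfolding filterlim_at using LIMSEQ_inverse_real_of_nat by (auto simp: inverse_eq_divide)
    ultimately have "((\<lambda>n. (F (x + (1 / real (Suc n)) *\<^sub>R b) z - F x z) / (1 / real (Suc n))) \<longlongrightarrow> gradient (\<lambda>y. F y z) x \<bullet> b) sequentially"
      by (rule filterlim_compose)
    then show ?thesis
      by simp
  qed
  then have lim: "(\<lambda>n. case p of (x, z) \<Rightarrow> (F (x + (1 / real (Suc n)) *\<^sub>R b) z - F x z) * real (Suc n))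
      \<longlonglongrightarrow> (case p of (x, z) \<Rightarrow> gradient (\<lambda>y. F y z) x) \<bullet> b" for p
    by (simp add: split_beta)
  show "(\<lambda>p. (case p of (x, z) \<Rightarrow> gradient (\<lambda>y. F y z) x) \<bullet> b) \<in> borel_measurable (borel \<Otimes>\<^sub>M borel)"
    by (rule borel_measurable_LIMSEQ_real[OF lim]) measurable
qed

section \<open>Geometric convolutions and scalar recursions\<close>

text \<open>\<open>c_const q v\<close> is the maximum of x^v q^x over real x > 0, attained at x = v
  / ln(1/q). The inequality \<open>ln y \<le> y - 1\<close> is applied to the ratio y of k to this
  maximizer.\<close>

lemma power_le_c_const_powr:
  fixes q v :: real
  assumes q: "0 < q" "q < 1" and "0 < v" "1 \<le> k"
  shows "q ^ k \<le> c_const q v * real k powr (- v)"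
proof -
  define l where "l = ln (1 / q)"
  have l: "0 < l"
    using q by (simp add: l_def)
  have k: "0 < real k"
    using assms by simp
  define y where "y = l * real k / v"
  have y: "0 < y"
    using l k \<open>0 < v\<close> by (simp add: y_def)
  have "q ^ k = exp (- (l * real k))"
    using q by (simp add: l_def ln_div exp_of_nat2_mult mult.commute flip: ln_realpow)
  also have "l * real k = v * y"
    using \<open>0 < v\<close> by (simp add: y_def)
  also have "exp (- (v * y)) \<le> exp (- v - v * ln y)"
  proof -
    have "v * ln y \<le> v * (y - 1)"
      using ln_le_minus_one[OF y] \<open>0 < v\<close> by simp
    then show ?thesis
      by (simp add: algebra_simps)
  qed
  also have "\<dots> = c_const q v * real k powr (- v)"
  proof -
    have "ln y = ln (real k) - ln (v / l)"
      using l k \<open>0 < v\<close> by (simp add: y_def ln_div ln_mult)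
    then have "v * ln y = v * ln (real k) - v * ln (v / l)"
      by (simp only: right_diff_distrib)
    then show ?thesis
      using l k \<open>0 < v\<close>
      by (simp add: c_const_def l_def[symmetric] powr_def mult_exp_exp algebra_simps)
  qed
  finally show ?thesis .
qed

text \<open>The ratio ((k+1)/k)^v is at most e^(v/k), and the threshold on k makes this at most
  q^(-1/2). So half of the geometric decay pays for the change of the power, and the other half
  remains for summation.\<close>

lemma powr_minus_ratio_le:
  fixes q v :: real
  assumes q: "0 < q" "q < 1" and "0 < v" and k: "2 * v / ln (1 / q) \<le> real k"
  shows "q * real k powr (- v) \<le> sqrt q * real (Suc k) powr (- v)"
proof -
  have l: "0 < ln (1 / q)"
    using q by simp
  have k0: "0 < real k"
    using l k \<open>0 < v\<close> by (smt (verit) divide_pos_pos)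
  have "v * (ln (real (Suc k)) - ln (real k)) \<le> v * (1 / real k)"
  proof -
    have "ln (real (Suc k)) - ln (real k) = ln (1 + 1 / real k)"
    proof -
      have "real (Suc k) / real k = 1 + 1 / real k"
        using k0 by (simp add: field_simps)
      moreover have "ln (real (Suc k) / real k) = ln (real (Suc k)) - ln (real k)"
        using k0 by (simp add: ln_div)
      ultimately show ?thesis
        by simp
    qed
    also have "\<dots> \<le> 1 / real k"
      using k0 by (intro ln_add_one_self_le_self) simp
    finally show ?thesis
      using \<open>0 < v\<close> by (intro mult_left_mono) auto
  qed
  also have "\<dots> \<le> ln (1 / q) / 2"
    using k k0 l by (simp add: field_simps)
  finally have "exp (ln q + - v * ln (real k)) \<le> exp (ln (sqrt q) + - v * ln (real (Suc k)))"
    using q by (simp add: ln_sqrt ln_div algebra_simps)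
  then show ?thesis
    using q k0 unfolding exp_add powr_def by (simp add: add_pos_pos)
qed

text \<open>Converts the sum of the geometric series with ratio \<open>sqrt q\<close> into the last
  summand of \<open>C_const\<close>. With s = sqrt q, \<open>ln (1 / s) \<le> 1 / s - 1\<close>
  multiplied by s^2 gives at most s(1 - s).\<close>

lemma inverse_one_minus_sqrt_le:
  fixes q :: real
  assumes q: "0 < q" "q < 1"
  shows "1 / (1 - sqrt q) \<le> 2 / (q * ln (1 / q))"
proof -
  define s where "s = sqrt q"
  have s: "0 < s" "s < 1" "q = s * s"
    using q by (auto simp: s_def)
  have "ln (1 / s) \<le> 1 / s - 1"
    using s by (intro ln_le_minus_one) simp
  then have "s * s * ln (1 / s) \<le> s * s * (1 / s - 1)"
    using s by (intro mult_left_mono) auto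
  also have "\<dots> = s * (1 - s)"
    using s by (simp add: field_simps)
  also have "\<dots> \<le> 1 - s"
    using s by (simp add: mult_left_le_one_le)
  finally have "q * ln (1 / q) \<le> 2 * (1 - s)"
    using s by (simp add: ln_div ln_mult)
  moreover have "0 < q * ln (1 / q)"
    using q by simp
  ultimately have "1 / (1 - s) \<le> 2 / (q * ln (1 / q))"
    using s by (simp add: field_simps)
  then show ?thesis
    by (simp add: s_def)
qed

text \<open>
  The head of the sum, where the ratio of consecutive terms may exceed \<open>sqrt q\<close>, is bounded by a
  geometric series; there \<open>q ^ k \<ge> q / exp (2 * v)\<close>.
\<close>

lemma geometric_powr_convolution_le:
  fixes q v :: real
  assumes q: "0 < q" "q < 1" and v: "0 < v" and "1 \<le> k"
  shows "(\<Sum>j=1..k. q ^ (k - j) * real j powr (- v))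
     \<le> q ^ k * ((exp (2 * v) * inverse q - 1) / (1 - q)) + 1 / (1 - sqrt q) * real k powr (- v)"
  using \<open>1 \<le> k\<close>
proof (induction k rule: dec_induct)
  case base
  have "1 * 1 \<le> exp (2 * v) * inverse q"
    using q v by (intro mult_mono) (auto simp: one_le_inverse)
  then have "0 \<le> q * ((exp (2 * v) * inverse q - 1) / (1 - q))"
    using q by simp
  moreover have "1 \<le> 1 / (1 - sqrt q)"
    using q by simp
  ultimately show ?case
    by simp
next
  case (step k)
  define A D T where "A = (exp (2 * v) * inverse q - 1) / (1 - q)" and "D = 1 / (1 - sqrt q)"
    and "T k = (\<Sum>j=1..k. q ^ (k - j) * real j powr (- v))" for k :: nat
  \<comment> \<open>\<open>D\<close> is the fixed point of the map D -> sqrt q * D + 1, so the tail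
    bound reproduces itself in the induction step.\<close>
  have D: "sqrt q * D + 1 = D" "0 \<le> D"
    using q by (auto simp: D_def field_simps)
  show ?case
  proof (cases "2 * v / ln (1 / q) \<le> real k")
    case True
    have "T (Suc k) = q * T k + real (Suc k) powr (- v)"
      unfolding T_def by (simp add: sum_distrib_left Suc_diff_le mult.assoc)
    also have "\<dots> \<le> q * (q ^ k * A + D * real k powr (- v)) + real (Suc k) powr (- v)"
      using step.IH q unfolding T_def A_def D_def by simp
    also have "\<dots> = q ^ Suc k * A + D * (q * real k powr (- v)) + real (Suc k) powr (- v)"
      by (simp add: algebra_simps)
    also have "\<dots> \<le> q ^ Suc k * A + D * (sqrt q * real (Suc k) powr (- v)) + real (Suc k) powr (- v)"
      using powr_minus_ratio_le[OF q v True] D by (intro add_mono mult_left_mono order_refl) auto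
    also have "\<dots> = q ^ Suc k * A + (sqrt q * D + 1) * real (Suc k) powr (- v)"
      by (simp add: algebra_simps)
    finally have "T (Suc k) \<le> q ^ Suc k * A + D * real (Suc k) powr (- v)"
      unfolding D .
    then show ?thesis
      unfolding T_def A_def D_def .
  next
    case False
    have l: "0 < ln (1 / q)"
      using q by simp
    have "T (Suc k) \<le> (\<Sum>j=1..Suc k. q ^ (Suc k - j) * 1)"
      unfolding T_def using q v
      by (intro sum_mono mult_left_mono) (auto simp: powr_minus ge_one_powr_ge_zero inverse_le_1_iff)
    also have "\<dots> = (\<Sum>i<Suc k. q ^ i)"
      by (rule sum.reindex_bij_witness[of _ "\<lambda>i. Suc k - i" "\<lambda>j. Suc k - j"]) auto
    also have "\<dots> = (1 - q ^ Suc k) / (1 - q)"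
      using q by (simp only: sum_gp_strict) auto
    also have "\<dots> \<le> q ^ Suc k * A"
    proof -
      have "1 \<le> q ^ Suc k * (exp (2 * v) * inverse q)"
      proof -
        have "1 = exp (0::real)" by simp
        also have "\<dots> \<le> exp (real k * ln q + 2 * v)"
          using False l q by (simp add: field_simps ln_div)
        also have "\<dots> = q ^ Suc k * (exp (2 * v) * inverse q)"
          using q by (simp add: exp_add exp_of_nat_mult)
        finally show ?thesis .
      qed
      then have "1 - q ^ Suc k \<le> q ^ Suc k * (exp (2 * v) * inverse q - 1)"
        by (simp add: algebra_simps)
      then show ?thesis
        using q by (simp add: A_def divide_right_mono)
    qed
    also have "\<dots> \<le> q ^ Suc k * A + D * real (Suc k) powr (- v)"
      using D by simp
    finally show ?thesis
      unfolding T_def A_def D_def .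
  qed
qed

lemma contraction_recursion_le:
  fixes e :: "nat \<Rightarrow> real"
  assumes q: "0 \<le> q" and rec: "\<And>k. e (Suc k) \<le> q * e k + s * real (Suc k) powr (- v)"
  shows "e k \<le> q ^ k * e 0 + s * (\<Sum>j=1..k. q ^ (k - j) * real j powr (- v))"
proof (induction k)
  case (Suc k)
  have "e (Suc k) \<le> q * (q ^ k * e 0 + s * (\<Sum>j=1..k. q ^ (k - j) * real j powr (- v))) + s * real (Suc k) powr (- v)"
    using rec[of k] mult_left_mono[OF Suc.IH q] by linarith
  also have "\<dots> = q ^ Suc k * e 0 + s * (\<Sum>j=1..Suc k. q ^ (Suc k - j) * real j powr (- v))"
    by (simp add: sum_distrib_left Suc_diff_le algebra_simps)
  finally show ?case .
qed simp

text \<open>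
  The constant \<open>C_const\<close> contains the factor \<open>ln (1 / q) powr (- v)\<close>, which is too large for a
  complexity bound that is uniform in \<open>v\<close>; the leading constant below does not depend on \<open>v\<close>.
\<close>

lemma contraction_recursion_asymptotics:
  fixes e :: "nat \<Rightarrow> real"
  assumes q: "0 \<le> q" "q < 1" and v: "0 < v" and s: "0 \<le> s"
    and rec: "\<And>k. e (Suc k) \<le> q * e k + s * real (Suc k) powr (- v)"
  shows "\<forall>\<^sub>F k in sequentially. e k \<le> (s / (1 - sqrt q) + 1) * real k powr (- v)"
\<comment> \<open>The convolution bound contains \<open>inverse q\<close>. For q = 0 the recursion
  has no memory and one step already gives the rate.\<close>
proof (cases "q = 0")
  case True
  have "e k \<le> (s / (1 - sqrt q) + 1) * real k powr (- v)" if k: "k \<ge> 1" for k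
  proof -
    obtain k' where k': "k = Suc k'"
      using k by (cases k) auto
    have "e k \<le> s * real k powr (- v)"
      using rec[of k'] True by (simp add: k')
    also have "\<dots> \<le> (s / (1 - sqrt q) + 1) * real k powr (- v)"
      using True by (intro mult_right_mono) auto
    finally show ?thesis .
  qed
  then show ?thesis
    by (rule eventually_sequentiallyI)
next
  case False
  with q have q: "0 < q" "q < 1" by auto
  define A where "A = e 0 + s * ((exp (2 * v) * inverse q - 1) / (1 - q))"
  \<comment> \<open>\<open>A\<close> collects everything that depends on the start and on v. Its
    term is o(k^(-v)), so eventually it costs only the summand 1 in the leading constant.\<close>
  have "(\<lambda>k. A * (real k powr v * q ^ k)) \<longlonglongrightarrow> A * 0"
  proof (intro tendsto_mult_left)
    have "((\<lambda>x::real. x powr v * exp (ln q * x)) \<longlongrightarrow> 0) at_top"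
      using q by real_asymp
    then have "((\<lambda>k::nat. real k powr v * exp (ln q * real k)) \<longlonglongrightarrow> 0)"
      by (rule filterlim_compose) (rule filterlim_real_sequentially)
    moreover have "exp (ln q * real k) = q ^ k" for k
      using q by (simp add: exp_of_nat2_mult)
    ultimately show "(\<lambda>k. real k powr v * q ^ k) \<longlonglongrightarrow> 0"
      by simp
  qed
  then have "\<forall>\<^sub>F k in sequentially. A * (real k powr v * q ^ k) < 1"
    by (rule order_tendstoD) simp
  then show ?thesis
    using eventually_ge_at_top[of 1]
  proof eventually_elim
    case (elim k)
    have "e k \<le> q ^ k * e 0 + s * (\<Sum>j=1..k. q ^ (k - j) * real j powr (- v))"
      using q rec by (intro contraction_recursion_le) auto
    also have "\<dots> \<le> q ^ k * e 0 + s * (q ^ k * ((exp (2 * v) * inverse q - 1) / (1 - q)) + 1 / (1 - sqrt q) * real k powr (- v))"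
      using q v s elim geometric_powr_convolution_le by (intro add_left_mono mult_left_mono) auto
    also have "\<dots> = A * q ^ k + s / (1 - sqrt q) * real k powr (- v)"
      by (simp add: A_def algebra_simps)
    also have "A * q ^ k = (A * (real k powr v * q ^ k)) * real k powr (- v)"
      using elim by (simp add: powr_minus)
    also have "\<dots> \<le> 1 * real k powr (- v)"
      using elim by (intro mult_right_mono) auto
    finally show ?case
      by (simp add: algebra_simps)
  qed
qed

text \<open>The three summands of \<open>C_const\<close> are the initial error, the head of the
  convolution and its tail. The first two carry \<open>q ^ k\<close>, which \<open>c_const\<close>
  turns into a power of k; the tail already has the right order.\<close>

lemma contraction_recursion_C_const:
  fixes e :: "nat \<Rightarrow> real"
  assumes q: "0 < q" "q < 1" and v: "0 < v" and k: "1 \<le> k" and e0: "0 \<le> e 0"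
    and rec: "\<And>k. e (Suc k) \<le> q * e k + \<alpha>\<^sup>2 * \<nu>\<^sup>2 * real (Suc k) powr (- v)"
  shows "e k \<le> C_const q \<alpha> \<nu> (e 0) v * real k powr (- v)"
proof -
  define s B where "s = \<alpha>\<^sup>2 * \<nu>\<^sup>2" and "B = (exp (2 * v) * inverse q - 1) / (1 - q)"
  have s: "0 \<le> s" by (simp add: s_def)
  have "1 * 1 \<le> exp (2 * v) * inverse q"
    using q v by (intro mult_mono) (auto simp: one_le_inverse)
  then have B: "0 \<le> B"
    using q by (simp add: B_def)
  have "e k \<le> q ^ k * e 0 + s * (\<Sum>j=1..k. q ^ (k - j) * real j powr (- v))"
    using q rec unfolding s_def by (intro contraction_recursion_le) auto
  also have "\<dots> \<le> q ^ k * e 0 + s * (q ^ k * B + 1 / (1 - sqrt q) * real k powr (- v))"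
    using q v s k geometric_powr_convolution_le unfolding B_def by (intro add_left_mono mult_left_mono) auto
  also have "\<dots> = q ^ k * (e 0 + s * B) + s * (1 / (1 - sqrt q)) * real k powr (- v)"
    by (simp add: algebra_simps)
  also have "\<dots> \<le> c_const q v * real k powr (- v) * (e 0 + s * B)
      + s * (2 / (q * ln (1 / q))) * real k powr (- v)"
    using power_le_c_const_powr[OF q v k] inverse_one_minus_sqrt_le[OF q] s B e0
    by (intro add_mono mult_right_mono mult_left_mono) auto
  also have "\<dots> = C_const q \<alpha> \<nu> (e 0) v * real k powr (- v)"
    by (simp add: C_const_def s_def B_def algebra_simps)
  finally show ?thesis .
qed

section \<open>Batch sizes and complexity counts\<close>

lemma batch_size_ge: "(real k + 1) powr v \<le> real (batch_size v k)"
  unfolding batch_size_def by linarith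

lemma batch_size_pos: "0 < batch_size v k"
proof -
  have "0 < (real k + 1) powr v" by simp
  then show ?thesis
    using batch_size_ge[of k v] by linarith
qed

lemma batch_size_le:
  assumes "0 < v"
  shows "real (batch_size v k) \<le> 2 * (real k + 1) powr v"
proof -
  have "1 \<le> (real k + 1) powr v"
    using assms by (intro ge_one_powr_ge_zero) auto
  then show ?thesis
    unfolding batch_size_def by linarith
qed

text \<open>Every batch is bounded by the last one. With K of order (1/\<epsilon>)^(1/v), the
  exponent v + 1 becomes 1 + 1/v.\<close>

lemma sum_batch_size_le:
  assumes "0 < v"
  shows "(\<Sum>k<K. real (batch_size v k)) \<le> 2 * real K powr (v + 1)"
proof -
  have "(\<Sum>k<K. real (batch_size v k)) \<le> (\<Sum>k<K. 2 * real K powr v)"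
  proof (rule sum_mono)
    fix k assume "k \<in> {..<K}"
    then have "(real k + 1) powr v \<le> real K powr v"
      using assms by (intro powr_mono2) auto
    then show "real (batch_size v k) \<le> 2 * real K powr v"
      using batch_size_le[OF assms, of k] by linarith
  qed
  also have "\<dots> = 2 * real K powr (v + 1)"
    by (cases "K = 0") (auto simp: powr_add)
  finally show ?thesis .
qed

text \<open>
  Rounding up to an integer costs a factor \<open>2 powr (v + 1)\<close> in the number of gradients;
  the factor \<open>exp v * v powr v \<ge> exp (2 * v - 1)\<close> absorbs it.
\<close>

lemma complexity_of_polynomial_rate:
  fixes D v0 :: real and e :: "nat \<Rightarrow> real"
  defines "B \<equiv> max (2 / v0 * D powr (1 / v0)) (4 * exp 1 * D powr (1 + 1 / v0))"
  assumes D: "1 \<le> D" and v0: "0 < v0" "v0 \<le> v"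
    and rate: "\<forall>\<^sub>F k in sequentially. e k \<le> D * real k powr (- v)"
  shows "\<forall>\<^sub>F \<epsilon> in at_right 0.
      real (LEAST K. e K \<le> \<epsilon>) \<le> B * (v * (1 / \<epsilon>) powr (1 / v)) \<and>
      real (\<Sum>k<(LEAST K. e K \<le> \<epsilon>). batch_size v k) \<le> B * (exp v * v powr v * (1 / \<epsilon>) powr (1 + 1 / v))"
proof -
  have v: "0 < v" using v0 by simp
  obtain k0 where k0: "\<And>k. k \<ge> k0 \<Longrightarrow> e k \<le> D * real k powr (- v)"
    using rate by (auto simp: eventually_sequentially)
  \<comment> \<open>How small \<epsilon> must be may depend on v and on \<open>k0\<close>; only the
    constant \<open>B\<close> has to be uniform.\<close>
  have "filterlim (\<lambda>\<epsilon>::real. (D / \<epsilon>) powr (1 / v)) at_top (at_right 0)"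
    using D v by real_asymp
  then have "\<forall>\<^sub>F \<epsilon> in at_right 0. max 1 (real k0) \<le> (D / \<epsilon>) powr (1 / v)"
    unfolding filterlim_at_top by blast
  moreover have "\<forall>\<^sub>F \<epsilon> in at_right (0::real). \<epsilon> > 0"
    by (rule eventually_at_right_less)
  ultimately show ?thesis
  proof eventually_elim
    case (elim \<epsilon>)
    define K where "K = (LEAST K. e K \<le> \<epsilon>)"
    \<comment> \<open>\<open>y\<close> solves D y^(-v) = \<epsilon>. The bounds y \<ge> 1 and y
      \<ge> \<open>k0\<close> let it be rounded up at the cost of a factor 2 and let the rate
      apply.\<close>
    define y where "y = (D / \<epsilon>) powr (1 / v)"
    define n where "n = nat \<lceil>y\<rceil>"
    have y: "1 \<le> y" "real k0 \<le> y"
      using elim by (auto simp: y_def)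
    have n: "y \<le> real n" "real n \<le> 2 * y"
      using y unfolding n_def by linarith+
    have "n \<ge> k0"
      using n y by linarith
    then have "e n \<le> D * real n powr (- v)"
      by (rule k0)
    also have "\<dots> \<le> D * y powr (- v)"
      using D y n v by (intro mult_left_mono powr_mono2') auto
    also have "\<dots> = \<epsilon>"
      using D v elim by (simp add: y_def powr_powr powr_minus)
    finally have "K \<le> n"
      unfolding K_def by (rule Least_le)
    with n have K: "real K \<le> 2 * y"
      by linarith
    have eps: "y = D powr (1 / v) * (1 / \<epsilon>) powr (1 / v)"
      using D elim by (simp add: y_def flip: powr_mult)
    \<comment> \<open>Together with D \<ge> 1 this replaces D^(1/v) by D^(1/v0), which removes v
      from the constant.\<close>
    have inv: "1 / v \<le> 1 / v0"
      using v0 by (simp add: frac_le)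
    have "real K \<le> B * (v * (1 / \<epsilon>) powr (1 / v))"
    proof -
      have "2 * y \<le> 2 * (D powr (1 / v0) * (1 / \<epsilon>) powr (1 / v))"
        unfolding eps using D inv by (intro mult_left_mono mult_right_mono powr_mono) auto
      \<comment> \<open>The factor v of the claimed bound is inserted through v / v0 \<ge> 1, which
        is why \<open>B\<close> contains 2 / v0.\<close>
      also have "\<dots> \<le> (v / v0) * (2 * (D powr (1 / v0) * (1 / \<epsilon>) powr (1 / v)))"
        using v0 mult_right_mono[of 1 "v / v0" "2 * (D powr (1 / v0) * (1 / \<epsilon>) powr (1 / v))"] by simp
      also have "\<dots> = 2 / v0 * D powr (1 / v0) * (v * (1 / \<epsilon>) powr (1 / v))"
        by (simp add: field_simps)
      also have "\<dots> \<le> B * (v * (1 / \<epsilon>) powr (1 / v))"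
        unfolding B_def using v by (intro mult_right_mono) auto
      finally show ?thesis
        using K by linarith
    qed
    moreover have "real (\<Sum>k<K. batch_size v k) \<le> B * (exp v * v powr v * (1 / \<epsilon>) powr (1 + 1 / v))"
    proof -
      have "2 powr v \<le> exp 1 * (exp v * v powr v)"
      proof -
        have "1 - 1 / v \<le> ln v"
          using ln_le_minus_one[of "1 / v"] v by (simp add: ln_div)
        then have "v * (1 - 1 / v) \<le> v * ln v"
          using v by (intro mult_left_mono) auto
        then have "v - 1 \<le> v * ln v"
          using v by (simp add: algebra_simps)
        moreover have "v * ln 2 \<le> v * 1"
          using v ln_le_minus_one[of 2] by (intro mult_left_mono) auto
        ultimately have "v * ln 2 \<le> 1 + (v + v * ln v)"
          using v by linarith
        then have "exp (v * ln 2) \<le> exp (1 + (v + v * ln v))"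
          by simp
        then show ?thesis
          using v by (simp add: exp_add powr_def)
      qed
      have "real (\<Sum>k<K. batch_size v k) \<le> 2 * real K powr (v + 1)"
        using sum_batch_size_le[OF v] by simp
      also have "\<dots> \<le> 2 * (2 * y) powr (v + 1)"
        using K v by (intro mult_left_mono powr_mono2) auto
      \<comment> \<open>One factor 2 comes from rounding the batch sizes and one from rounding
        \<open>y\<close>; their product is the 4 in \<open>B\<close>.\<close>
      also have "\<dots> = 4 * (2 powr v * y powr (v + 1))"
        using y by (simp add: powr_mult powr_add)
      also have "y powr (v + 1) = D powr (1 + 1 / v) * (1 / \<epsilon>) powr (1 + 1 / v)"
      proof -
        have "1 / v * (v + 1) = 1 + 1 / v"
          using v by (simp add: field_simps)
        then show ?thesis
          using D elim unfolding eps by (simp add: powr_mult powr_powr)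
      qed
      also have "4 * (2 powr v * (D powr (1 + 1 / v) * (1 / \<epsilon>) powr (1 + 1 / v)))
          \<le> 4 * ((exp 1 * (exp v * v powr v)) * (D powr (1 + 1 / v0) * (1 / \<epsilon>) powr (1 + 1 / v)))"
        using D inv \<open>2 powr v \<le> exp 1 * (exp v * v powr v)\<close>
        by (intro mult_left_mono mult_mono mult_right_mono powr_mono) auto
      also have "\<dots> = 4 * exp 1 * D powr (1 + 1 / v0) * (exp v * v powr v * (1 / \<epsilon>) powr (1 + 1 / v))"
        by simp
      also have "\<dots> \<le> B * (exp v * v powr v * (1 / \<epsilon>) powr (1 + 1 / v))"
        unfolding B_def by (intro mult_right_mono) auto
      finally show ?thesis .
    qed
    ultimately show ?case
      unfolding K_def by simp
  qed
qed

section \<open>Independence of the initial point and the samples\<close>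

text \<open>Merges two kinds of independence, that of the samples among each other and that of the
  initial point from the samples as a whole, into one family. In a product formula the index
  \<open>None\<close> is split off first; this requires the intersection of the remaining events to
  lie in \<open>B\<close>.\<close>

lemma (in prob_space) indep_sets_case_option:
  assumes AB: "indep_set A B" and E: "indep_sets E I"
    and Int: "\<And>J F. finite J \<Longrightarrow> J \<noteq> {} \<Longrightarrow> J \<subseteq> I \<Longrightarrow> (\<And>j. j \<in> J \<Longrightarrow> F j \<in> E j) \<Longrightarrow> (\<Inter>j\<in>J. F j) \<in> B"
  shows "indep_sets (case_option A E) (insert None (Some ` I))"
proof (rule indep_setsI)
  fix i assume "i \<in> insert None (Some ` I)"
  then show "case_option A E i \<subseteq> events"
    using indep_setD_ev1[OF AB] E by (auto simp: indep_sets_def subset_eq)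
next
  fix F J
  assume J: "J \<noteq> {}" "J \<subseteq> insert None (Some ` I)" "finite J" and F: "\<forall>j\<in>J. F j \<in> case_option A E j"
  define K where "K = {i. Some i \<in> J}"
  have JK: "J = Some ` K \<or> J = insert None (Some ` K)"
    unfolding K_def by (auto simp: image_iff) (metis option.exhaust)+
  have "finite (Some ` K)"
    using J by (auto simp: K_def intro: finite_subset)
  then have K: "finite K" "K \<subseteq> I"
    using J by (auto simp: K_def dest: finite_imageD)
  have FK: "\<And>i. i \<in> K \<Longrightarrow> F (Some i) \<in> E i"
    using F by (auto simp: K_def)
  have prodK: "prob (\<Inter>i\<in>K. F (Some i)) = (\<Prod>i\<in>K. prob (F (Some i)))" if "K \<noteq> {}"
    using indep_setsD[OF E, of K "\<lambda>i. F (Some i)"] K FK that by auto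
  from JK show "prob (\<Inter>j\<in>J. F j) = (\<Prod>j\<in>J. prob (F j))"
  proof
    assume "J = Some ` K"
    then show ?thesis
      using J prodK by (simp add: prod.reindex)
  next
    assume JK: "J = insert None (Some ` K)"
    show ?thesis
    proof (cases "K = {}")
      case False
      have "F None \<in> A"
        using F JK by auto
      moreover have "(\<Inter>i\<in>K. F (Some i)) \<in> B"
        using False K FK by (intro Int) auto
      ultimately have "prob (F None \<inter> (\<Inter>i\<in>K. F (Some i))) = prob (F None) * prob (\<Inter>i\<in>K. F (Some i))"
        by (rule indep_setD[OF AB])
      then show ?thesis
        using prodK[OF False] K by (simp add: JK prod.reindex)
    qed (simp add: JK)
  qed
qed

text \<open>The index \<open>None\<close> stands for the initial point. Histories, single samples
  and parts of a batch thus become index sets of one family, and independence reduces to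
  disjointness.\<close>

definition sample_events ::
  "'w measure \<Rightarrow> ('w \<Rightarrow> real^'m) \<Rightarrow> (nat \<Rightarrow> nat \<Rightarrow> 'w \<Rightarrow> real^'d) \<Rightarrow> (nat \<times> nat) option \<Rightarrow> 'w set set"
where
  "sample_events M x0 \<Xi> = case_option {x0 -` A \<inter> space M | A. A \<in> sets borel}
     (\<lambda>(j, k). {\<Xi> j k -` A \<inter> space M | A. A \<in> sets borel})"

definition sample_algebra ::
  "'w measure \<Rightarrow> ('w \<Rightarrow> real^'m) \<Rightarrow> (nat \<Rightarrow> nat \<Rightarrow> 'w \<Rightarrow> real^'d) \<Rightarrow> (nat \<times> nat) option set \<Rightarrow> 'w measure"
where
  "sample_algebra M x0 \<Xi> J = sigma (space M) (\<Union>i\<in>J. sample_events M x0 \<Xi> i)"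

definition history_index :: "(nat \<Rightarrow> nat) \<Rightarrow> nat \<Rightarrow> (nat \<times> nat) option set" where
  "history_index N k = insert None (Some ` {(j, t). (j, t) \<in> sample_index N \<and> t < k})"

lemma sample_events_subset_Pow: "(\<Union>i\<in>J. sample_events M x0 \<Xi> i) \<subseteq> Pow (space M)"
  by (auto simp: sample_events_def split: option.splits)

lemma space_sample_algebra [simp]: "space (sample_algebra M x0 \<Xi> J) = space M"
  unfolding sample_algebra_def by (rule space_measure_of[OF sample_events_subset_Pow])

lemma sets_sample_algebra: "sets (sample_algebra M x0 \<Xi> J) = sigma_sets (space M) (\<Union>i\<in>J. sample_events M x0 \<Xi> i)"
  unfolding sample_algebra_def by (rule sets_measure_of[OF sample_events_subset_Pow])

lemma sets_sample_algebra_mono: "J \<subseteq> J' \<Longrightarrow> sets (sample_algebra M x0 \<Xi> J) \<subseteq> sets (sample_algebra M x0 \<Xi> J')"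
  unfolding sets_sample_algebra by (intro sigma_sets_mono' UN_mono) auto

lemma measurable_sample_algebra_mono:
  assumes "J \<subseteq> J'" "X \<in> measurable (sample_algebra M x0 \<Xi> J) S"
  shows "X \<in> measurable (sample_algebra M x0 \<Xi> J') S"
proof (rule measurableI)
  fix A assume "A \<in> sets S"
  then show "X -` A \<inter> space (sample_algebra M x0 \<Xi> J') \<in> sets (sample_algebra M x0 \<Xi> J')"
    using measurable_sets[OF assms(2)] by (auto intro: subsetD[OF sets_sample_algebra_mono[OF assms(1)]])
qed (use measurable_space[OF assms(2)] in simp)

lemma measurable_initial_sample_algebra:
  fixes x0 :: "'w \<Rightarrow> real^'m"
  assumes "None \<in> J"
  shows "x0 \<in> borel_measurable (sample_algebra M x0 \<Xi> J)"
proof (rule measurableI)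
  fix A :: "(real^'m) set" assume "A \<in> sets borel"
  then have "x0 -` A \<inter> space M \<in> (\<Union>i\<in>J. sample_events M x0 \<Xi> i)"
    using assms by (force simp: sample_events_def intro!: bexI[of _ None])
  then show "x0 -` A \<inter> space (sample_algebra M x0 \<Xi> J) \<in> sets (sample_algebra M x0 \<Xi> J)"
    unfolding sets_sample_algebra by auto
qed auto

lemma measurable_sample_sample_algebra:
  fixes \<Xi> :: "nat \<Rightarrow> nat \<Rightarrow> 'w \<Rightarrow> real^'d"
  assumes "Some (j, k) \<in> J"
  shows "\<Xi> j k \<in> borel_measurable (sample_algebra M x0 \<Xi> J)"
proof (rule measurableI)
  fix A :: "(real^'d) set" assume "A \<in> sets borel"
  then have "\<Xi> j k -` A \<inter> space M \<in> (\<Union>i\<in>J. sample_events M x0 \<Xi> i)"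
    using assms by (force simp: sample_events_def intro!: bexI[of _ "Some (j, k)"])
  then show "\<Xi> j k -` A \<inter> space (sample_algebra M x0 \<Xi> J) \<in> sets (sample_algebra M x0 \<Xi> J)"
    unfolding sets_sample_algebra by auto
qed auto

lemma history_eq_sample_algebra: "history M x0 N \<Xi> k = sample_algebra M x0 \<Xi> (history_index N k)"
  unfolding history_def sample_algebra_def
  by (rule arg_cong[where f = "sigma (space M)"]) (force simp: sample_events_def history_index_def)

lemma Int_stable_vimage_sets: "Int_stable {X -` A \<inter> Q | A. A \<in> sets S}"
proof (rule Int_stableI)
  fix a b assume "a \<in> {X -` A \<inter> Q | A. A \<in> sets S}" "b \<in> {X -` A \<inter> Q | A. A \<in> sets S}"
  then obtain A B where "A \<in> sets S" "B \<in> sets S" "a = X -` A \<inter> Q" "b = X -` B \<inter> Q"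
    by auto
  then show "a \<inter> b \<in> {X -` A \<inter> Q | A. A \<in> sets S}"
    by (intro CollectI exI[of _ "A \<inter> B"]) auto
qed

lemma Int_stable_sample_events: "Int_stable (sample_events M x0 \<Xi> i)"
  by (auto simp: sample_events_def Int_stable_vimage_sets split: option.splits)

lemma (in prob_space) indep_sets_sample_events:
  assumes "iid_samples M \<xi> x0 N \<Xi>"
  shows "indep_sets (sample_events M x0 \<Xi>) (insert None (Some ` sample_index N))"
  unfolding sample_events_def
proof (rule indep_sets_case_option)
  let ?X = "\<lambda>\<omega>. \<lambda>(j, k)\<in>sample_index N. \<Xi> j k \<omega>"
  let ?B = "{?X -` A \<inter> space M | A. A \<in> sets (PiM (sample_index N) (\<lambda>_. borel))}"
  show "indep_set {x0 -` A \<inter> space M | A. A \<in> sets borel} ?B"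
    using assms by (simp add: iid_samples_def)
  show "indep_sets (\<lambda>(j, k). {\<Xi> j k -` A \<inter> space M | A. A \<in> sets borel}) (sample_index N)"
    using assms by (simp add: iid_samples_def indep_vars_def2 case_prod_unfold)
  fix J F
  assume J: "finite J" "J \<noteq> {}" "J \<subseteq> sample_index N"
    and "\<And>j. j \<in> J \<Longrightarrow> F j \<in> (\<lambda>(j, k). {\<Xi> j k -` A \<inter> space M | A. A \<in> sets borel}) j"
  then have "\<exists>A. A \<in> sets borel \<and> F j = (case j of (j, k) \<Rightarrow> \<Xi> j k) -` A \<inter> space M" if "j \<in> J" for j
    using that by (cases j) force
  then obtain A where A: "\<And>j. j \<in> J \<Longrightarrow> A j \<in> sets borel"
      "\<And>j. j \<in> J \<Longrightarrow> F j = (case j of (j, k) \<Rightarrow> \<Xi> j k) -` A j \<inter> space M"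
    by metis
  \<comment> \<open>The hypothesis on the initial point speaks of the product sigma-algebra of the
    whole sample array, so a finite intersection of sample events is written as the preimage of a
    cylinder.\<close>
  define C where "C = prod_emb (sample_index N) (\<lambda>_. borel) J (Pi\<^sub>E J A)"
  have "C \<in> sets (PiM (sample_index N) (\<lambda>_. borel))"
    unfolding C_def using J A by (intro sets_PiM_I) auto
  moreover have "(\<Inter>j\<in>J. F j) = ?X -` C \<inter> space M"
  proof -
    have C_iff: "?X \<omega> \<in> C \<longleftrightarrow> (\<forall>j\<in>J. (case j of (j, k) \<Rightarrow> \<Xi> j k) \<omega> \<in> A j)" for \<omega>
    proof -
      have "restrict (?X \<omega>) J \<in> Pi\<^sub>E J A \<longleftrightarrow> (\<forall>j\<in>J. ?X \<omega> j \<in> A j)"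
        by (auto simp: PiE_iff extensional_def)
      also have "\<dots> \<longleftrightarrow> (\<forall>j\<in>J. (case j of (j, k) \<Rightarrow> \<Xi> j k) \<omega> \<in> A j)"
        using J(3) by (intro ball_cong) (auto simp: case_prod_unfold)
      finally show ?thesis
        by (simp add: C_def prod_emb_iff)
    qed
    have "(\<Inter>j\<in>J. F j) = (\<Inter>j\<in>J. (case j of (j, k) \<Rightarrow> \<Xi> j k) -` A j \<inter> space M)"
      by (rule INF_cong[OF refl A(2)])
    also have "\<dots> = ?X -` C \<inter> space M"
    proof (rule set_eqI)
      fix \<omega>
      show "\<omega> \<in> (\<Inter>j\<in>J. (case j of (j, k) \<Rightarrow> \<Xi> j k) -` A j \<inter> space M) \<longleftrightarrow> \<omega> \<in> ?X -` C \<inter> space M"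
        unfolding Int_iff vimage_eq C_iff INT_iff using J(2) by blast
    qed
    finally show ?thesis .
  qed
  ultimately show "(\<Inter>j\<in>J. F j) \<in> ?B"
    by blast
qed

lemma (in prob_space) sets_sample_algebra_subset_events:
  assumes "iid_samples M \<xi> x0 N \<Xi>" and "J \<subseteq> insert None (Some ` sample_index N)"
  shows "sets (sample_algebra M x0 \<Xi> J) \<subseteq> events"
  unfolding sets_sample_algebra
  using indep_sets_sample_events[OF assms(1)] assms(2)
  by (intro sets.sigma_sets_subset UN_least) (auto simp: indep_sets_def)

lemma (in prob_space) subalgebra_sample_algebra:
  assumes "iid_samples M \<xi> x0 N \<Xi>" and "J \<subseteq> insert None (Some ` sample_index N)"
  shows "subalgebra M (sample_algebra M x0 \<Xi> J)"
  using sets_sample_algebra_subset_events[OF assms] by (simp add: subalgebra_def)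

text \<open>The generating events of each index are closed under intersection, so mutual
  independence passes to the sigma-algebras generated by disjoint blocks. It is applied to a history
  with further samples against one fresh sample.\<close>

lemma (in prob_space) indep_sample_algebras:
  assumes iid: "iid_samples M \<xi> x0 N \<Xi>"
    and J: "J \<union> J' \<subseteq> insert None (Some ` sample_index N)" "J \<inter> J' = {}"
  shows "indep_set (sets (sample_algebra M x0 \<Xi> J)) (sets (sample_algebra M x0 \<Xi> J'))"
proof -
  let ?A = "\<lambda>b. case_bool J J' b"
  have "indep_sets (\<lambda>b. sigma_sets (space M) (\<Union>i\<in>?A b. sample_events M x0 \<Xi> i)) UNIV"
  proof (rule indep_sets_collect_sigma)
    show "indep_sets (sample_events M x0 \<Xi>) (\<Union>b\<in>UNIV. ?A b)"
      using J by (intro indep_sets_mono_index[OF _ indep_sets_sample_events[OF iid]])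
        (auto split: bool.splits)
    show "disjoint_family_on ?A UNIV"
      using J by (auto simp: disjoint_family_on_def split: bool.splits)
  qed (rule Int_stable_sample_events)
  then show ?thesis
    unfolding indep_set_def sets_sample_algebra
    by (rule indep_sets_mono_sets) (auto split: bool.splits)
qed

section \<open>Integration over an independent argument\<close>

lemma (in prob_space) distr_pair_indep_subalgebras:
  assumes sub: "subalgebra M A" "subalgebra M B" and ind: "indep_set (sets A) (sets B)"
    and X: "X \<in> measurable A S" and Z: "Z \<in> measurable B T"
  shows "distr M S X \<Otimes>\<^sub>M distr M T Z = distr M (S \<Otimes>\<^sub>M T) (\<lambda>\<omega>. (X \<omega>, Z \<omega>))"
proof (rule pair_measure_eqI)
  have XM[measurable]: "X \<in> measurable M S" and ZM[measurable]: "Z \<in> measurable M T"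
    using X Z sub by (auto intro: measurable_from_subalg)
  show "sigma_finite_measure (distr M S X)" "sigma_finite_measure (distr M T Z)"
    by (auto intro!: prob_space_imp_sigma_finite prob_space_distr)
  show "sets (distr M S X \<Otimes>\<^sub>M distr M T Z) = sets (distr M (S \<Otimes>\<^sub>M T) (\<lambda>\<omega>. (X \<omega>, Z \<omega>)))"
    by (simp cong: sets_pair_measure_cong)
  fix C D assume "C \<in> sets (distr M S X)" "D \<in> sets (distr M T Z)"
  then have C[measurable]: "C \<in> sets S" and D[measurable]: "D \<in> sets T"
    by auto
  have "space A = space M" "space B = space M"
    using sub by (auto simp: subalgebra_def)
  then have "X -` C \<inter> space M \<in> sets A" "Z -` D \<inter> space M \<in> sets B"
    using measurable_sets[OF X C] measurable_sets[OF Z D] by auto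
  from indep_setD[OF ind this]
  have "prob ((X -` C \<inter> space M) \<inter> (Z -` D \<inter> space M)) = prob (X -` C \<inter> space M) * prob (Z -` D \<inter> space M)" .
  moreover have "(X -` C \<inter> space M) \<inter> (Z -` D \<inter> space M) = (\<lambda>\<omega>. (X \<omega>, Z \<omega>)) -` (C \<times> D) \<inter> space M"
    by auto
  ultimately show "emeasure (distr M S X) C * emeasure (distr M T Z) D
      = emeasure (distr M (S \<Otimes>\<^sub>M T) (\<lambda>\<omega>. (X \<omega>, Z \<omega>))) (C \<times> D)"
    by (simp add: emeasure_distr emeasure_eq_measure ennreal_mult)
qed

text \<open>Fubini for the product law of (X, Z): the argument measurable in \<open>A\<close> is
  frozen and the independent one is integrated out. Independence is required of sigma-algebras
  rather than of X and Z, so that X can later be enlarged by any other variable measurable in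
  \<open>A\<close>.\<close>

lemma (in prob_space)
  fixes \<phi> :: "'b \<times> 'c \<Rightarrow> real"
  assumes sub: "subalgebra M A" "subalgebra M B" and ind: "indep_set (sets A) (sets B)"
    and X: "X \<in> measurable A S" and Z: "Z \<in> measurable B T"
    and \<phi>[measurable]: "\<phi> \<in> borel_measurable (S \<Otimes>\<^sub>M T)"
  shows borel_measurable_indep_expectation: "(\<lambda>x. expectation (\<lambda>\<omega>. \<phi> (x, Z \<omega>))) \<in> borel_measurable S"
    and integrable_indep_expectation:
      "integrable M (\<lambda>\<omega>. \<phi> (X \<omega>, Z \<omega>)) \<Longrightarrow> integrable M (\<lambda>\<omega>. expectation (\<lambda>\<omega>'. \<phi> (X \<omega>, Z \<omega>')))"
    and indep_expectation_fubini:
      "integrable M (\<lambda>\<omega>. \<phi> (X \<omega>, Z \<omega>)) \<Longrightarrow>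
        expectation (\<lambda>\<omega>. \<phi> (X \<omega>, Z \<omega>)) = expectation (\<lambda>\<omega>. expectation (\<lambda>\<omega>'. \<phi> (X \<omega>, Z \<omega>')))"
proof -
  have XM[measurable]: "X \<in> measurable M S" and ZM[measurable]: "Z \<in> measurable M T"
    using X Z sub by (auto intro: measurable_from_subalg)
  interpret D1: prob_space "distr M S X" by (rule prob_space_distr) fact
  interpret D2: prob_space "distr M T Z" by (rule prob_space_distr) fact
  interpret D: pair_prob_space "distr M S X" "distr M T Z" ..
  have eq: "expectation (\<lambda>\<omega>. \<phi> (x, Z \<omega>)) = (\<integral>z. \<phi> (x, z) \<partial>distr M T Z)" if "x \<in> space S" for x
    using that by (subst integral_distr) auto
  have "(\<lambda>x. \<integral>z. \<phi> (x, z) \<partial>distr M T Z) \<in> borel_measurable S"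
    by measurable
  then show meas[measurable]: "(\<lambda>x. expectation (\<lambda>\<omega>. \<phi> (x, Z \<omega>))) \<in> borel_measurable S"
    by (subst measurable_cong[OF eq])
  have pair: "distr M S X \<Otimes>\<^sub>M distr M T Z = distr M (S \<Otimes>\<^sub>M T) (\<lambda>\<omega>. (X \<omega>, Z \<omega>))"
    by (rule distr_pair_indep_subalgebras[OF sub ind X Z])
  assume int: "integrable M (\<lambda>\<omega>. \<phi> (X \<omega>, Z \<omega>))"
  then have int': "integrable (distr M S X \<Otimes>\<^sub>M distr M T Z) \<phi>"
    unfolding pair by (subst integrable_distr_eq) auto
  have "integrable (distr M S X) (\<lambda>x. \<integral>z. \<phi> (x, z) \<partial>distr M T Z)"
    using D.integrable_fst'[OF int'] .
  then have "integrable M (\<lambda>\<omega>. \<integral>z. \<phi> (X \<omega>, z) \<partial>distr M T Z)"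
    by (subst (asm) integrable_distr_eq) auto
  then show "integrable M (\<lambda>\<omega>. expectation (\<lambda>\<omega>'. \<phi> (X \<omega>, Z \<omega>')))"
    by (subst Bochner_Integration.integrable_cong[OF refl eq]) (auto intro: measurable_space[OF XM])
  have "expectation (\<lambda>\<omega>. \<phi> (X \<omega>, Z \<omega>)) = (\<integral>p. \<phi> p \<partial>(distr M S X \<Otimes>\<^sub>M distr M T Z))"
    unfolding pair by (subst integral_distr) auto
  also have "\<dots> = (\<integral>x. (\<integral>z. \<phi> (x, z) \<partial>distr M T Z) \<partial>distr M S X)"
    using D.integral_fst'[OF int'] by simp
  also have "\<dots> = expectation (\<lambda>\<omega>. \<integral>z. \<phi> (X \<omega>, z) \<partial>distr M T Z)"
    by (subst integral_distr) auto
  also have "\<dots> = expectation (\<lambda>\<omega>. expectation (\<lambda>\<omega>'. \<phi> (X \<omega>, Z \<omega>')))"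
    by (rule Bochner_Integration.integral_cong) (auto simp: eq measurable_space[OF XM])
  finally show "expectation (\<lambda>\<omega>. \<phi> (X \<omega>, Z \<omega>)) = expectation (\<lambda>\<omega>. expectation (\<lambda>\<omega>'. \<phi> (X \<omega>, Z \<omega>')))" .
qed

text \<open>
  Testing with the sign of \<open>\<lambda>x. expectation (\<lambda>\<omega>. \<gamma> (x, Z \<omega>))\<close> shows that this function vanishes
  almost everywhere under the law of \<open>X\<close>.
\<close>

lemma (in prob_space) indep_conditional_mean_zero:
  fixes \<gamma> :: "'b \<times> 'c \<Rightarrow> real"
  assumes sub: "subalgebra M A" "subalgebra M B" and ind: "indep_set (sets A) (sets B)"
    and X: "X \<in> measurable A S" and Y: "Y \<in> borel_measurable A" and Z: "Z \<in> measurable B T"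
    and \<gamma>[measurable]: "\<gamma> \<in> borel_measurable (S \<Otimes>\<^sub>M T)"
    and int: "integrable M (\<lambda>\<omega>. \<gamma> (X \<omega>, Z \<omega>))" "integrable M (\<lambda>\<omega>. Y \<omega> * \<gamma> (X \<omega>, Z \<omega>))"
    and zero: "\<And>s. s \<in> borel_measurable S \<Longrightarrow> (\<And>x. \<bar>s x\<bar> \<le> 1) \<Longrightarrow> expectation (\<lambda>\<omega>. s (X \<omega>) * \<gamma> (X \<omega>, Z \<omega>)) = 0"
  shows "expectation (\<lambda>\<omega>. Y \<omega> * \<gamma> (X \<omega>, Z \<omega>)) = 0"
proof -
  define h where "h x = expectation (\<lambda>\<omega>. \<gamma> (x, Z \<omega>))" for x
  note [measurable] = measurable_from_subalg[OF sub(1) X] measurable_from_subalg[OF sub(1) Y]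
    measurable_from_subalg[OF sub(2) Z]
  \<comment> \<open>Fubini is used a second time with Y adjoined to X. This lets Y depend on all of
    \<open>A\<close>, although \<open>zero\<close> only tests with functions of X.\<close>
  have XY: "(\<lambda>\<omega>. (X \<omega>, Y \<omega>)) \<in> measurable A (S \<Otimes>\<^sub>M borel)"
    using X Y by measurable
  have h[measurable]: "h \<in> borel_measurable S"
    unfolding h_def by (rule borel_measurable_indep_expectation[OF sub ind X Z \<gamma>])
  have inth: "integrable M (\<lambda>\<omega>. h (X \<omega>))"
    unfolding h_def by (rule integrable_indep_expectation[OF sub ind X Z \<gamma> int(1)])
  have "integrable M (\<lambda>\<omega>. sgn (h (X \<omega>)) * \<gamma> (X \<omega>, Z \<omega>))"
    by (rule Bochner_Integration.integrable_bound[OF int(1)]) (auto simp: abs_mult abs_sgn_eq)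
  then have "expectation (\<lambda>\<omega>. sgn (h (X \<omega>)) * \<gamma> (X \<omega>, Z \<omega>))
      = expectation (\<lambda>\<omega>. expectation (\<lambda>\<omega>'. sgn (h (X \<omega>)) * \<gamma> (X \<omega>, Z \<omega>')))"
    using indep_expectation_fubini[OF sub ind X Z, of "\<lambda>p. sgn (h (fst p)) * \<gamma> p"] by simp
  also have "\<dots> = expectation (\<lambda>\<omega>. \<bar>h (X \<omega>)\<bar>)"
    by (simp add: h_def[symmetric] mult.commute[of "sgn _"] flip: abs_sgn)
  finally have "expectation (\<lambda>\<omega>. \<bar>h (X \<omega>)\<bar>) = 0"
    using zero[of "\<lambda>x. sgn (h x)"] by (simp add: abs_sgn_eq)
  then have "AE \<omega> in M. h (X \<omega>) = 0"
    using inth by (subst (asm) integral_nonneg_eq_0_iff_AE) auto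
  then have 0: "expectation (\<lambda>\<omega>. Y \<omega> * h (X \<omega>)) = 0"
    by (intro integral_eq_zero_AE) auto
  have "expectation (\<lambda>\<omega>. Y \<omega> * \<gamma> (X \<omega>, Z \<omega>))
      = expectation (\<lambda>\<omega>. expectation (\<lambda>\<omega>'. Y \<omega> * \<gamma> (X \<omega>, Z \<omega>')))"
    using indep_expectation_fubini[OF sub ind XY Z, of "\<lambda>p. snd (fst p) * \<gamma> (fst (fst p), snd p)"] int(2) by simp
  then show ?thesis
    using 0 by (simp add: h_def[symmetric])
qed

section \<open>Square-integrable random vectors\<close>

definition square_integrable :: "'w measure \<Rightarrow> ('w \<Rightarrow> 'a::euclidean_space) \<Rightarrow> bool" where
  "square_integrable M X \<longleftrightarrow> X \<in> borel_measurable M \<and> integrable M (\<lambda>\<omega>. (norm (X \<omega>))\<^sup>2)"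

lemma square_integrable_bound:
  assumes "square_integrable M X" "Y \<in> borel_measurable M" "\<And>\<omega>. norm (Y \<omega>) \<le> c * norm (X \<omega>)"
  shows "square_integrable M Y"
proof -
  have "integrable M (\<lambda>\<omega>. c\<^sup>2 * (norm (X \<omega>))\<^sup>2)"
    using assms by (auto simp: square_integrable_def)
  moreover have "(norm (Y \<omega>))\<^sup>2 \<le> c\<^sup>2 * (norm (X \<omega>))\<^sup>2" for \<omega>
    using power_mono[OF assms(3), of \<omega> 2] by (simp add: power_mult_distrib)
  ultimately have "integrable M (\<lambda>\<omega>. (norm (Y \<omega>))\<^sup>2)"
    using assms(2) by (elim Bochner_Integration.integrable_bound) auto
  then show ?thesis
    using assms(2) by (simp add: square_integrable_def)
qed

lemma square_integrable_scaleR: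
  "square_integrable M X \<Longrightarrow> square_integrable M (\<lambda>\<omega>. c *\<^sub>R X \<omega>)"
  by (rule square_integrable_bound[where c = "\<bar>c\<bar>"]) (auto simp: square_integrable_def)

lemma square_integrable_add:
  assumes "square_integrable M X" "square_integrable M Y"
  shows "square_integrable M (\<lambda>\<omega>. X \<omega> + Y \<omega>)"
proof -
  have "(norm (X \<omega> + Y \<omega>))\<^sup>2 \<le> 2 * (norm (X \<omega>))\<^sup>2 + 2 * (norm (Y \<omega>))\<^sup>2" for \<omega>
  proof -
    have "(norm (X \<omega> + Y \<omega>))\<^sup>2 \<le> (norm (X \<omega>) + norm (Y \<omega>))\<^sup>2"
      by (intro power_mono norm_triangle_ineq) auto
    also have "\<dots> \<le> 2 * (norm (X \<omega>))\<^sup>2 + 2 * (norm (Y \<omega>))\<^sup>2"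
      using sum_squares_bound[of "norm (X \<omega>)" "norm (Y \<omega>)"] by (simp add: power2_sum)
    finally show ?thesis .
  qed
  moreover have "integrable M (\<lambda>\<omega>. 2 * (norm (X \<omega>))\<^sup>2 + 2 * (norm (Y \<omega>))\<^sup>2)"
    using assms by (auto simp: square_integrable_def)
  moreover have "(\<lambda>\<omega>. X \<omega> + Y \<omega>) \<in> borel_measurable M"
    using assms by (auto simp: square_integrable_def)
  ultimately show ?thesis
    unfolding square_integrable_def by (auto elim!: Bochner_Integration.integrable_bound)
qed

lemma square_integrable_diff:
  "square_integrable M X \<Longrightarrow> square_integrable M Y \<Longrightarrow> square_integrable M (\<lambda>\<omega>. X \<omega> - Y \<omega>)"
  using square_integrable_add[OF _ square_integrable_scaleR[of M Y "-1"]] by simp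

lemma square_integrable_sum:
  assumes "\<And>i. i \<in> I \<Longrightarrow> square_integrable M (X i)"
  shows "square_integrable M (\<lambda>\<omega>. \<Sum>i\<in>I. X i \<omega>)"
  using assms
proof (induction I rule: infinite_finite_induct)
  case (insert i I)
  then show ?case
    by (simp add: square_integrable_add)
qed (auto simp: square_integrable_def)

lemma borel_measurable_vec_nth: "(\<lambda>x::real^'n. x $ i) \<in> borel_measurable borel"
  by (intro borel_measurable_continuous_onI continuous_on_component continuous_on_id)

lemma square_integrable_vec_nth:
  fixes X :: "'w \<Rightarrow> real^'n"
  shows "square_integrable M X \<Longrightarrow> square_integrable M (\<lambda>\<omega>. X \<omega> $ i)"
  by (rule square_integrable_bound[where c = 1]) (auto simp: square_integrable_def component_le_norm_cart
    intro: measurable_compose[OF _ borel_measurable_vec_nth])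

lemma integrable_inner_square_integrable:
  assumes "square_integrable M X" "square_integrable M Y"
  shows "integrable M (\<lambda>\<omega>. X \<omega> \<bullet> Y \<omega>)"
proof -
  have "\<bar>X \<omega> \<bullet> Y \<omega>\<bar> \<le> (norm (X \<omega>))\<^sup>2 + (norm (Y \<omega>))\<^sup>2" for \<omega>
  proof -
    have "\<bar>X \<omega> \<bullet> Y \<omega>\<bar> \<le> norm (X \<omega>) * norm (Y \<omega>)"
      by (rule Cauchy_Schwarz_ineq2)
    also have "\<dots> \<le> 2 * norm (X \<omega>) * norm (Y \<omega>)"
      by simp
    also have "\<dots> \<le> (norm (X \<omega>))\<^sup>2 + (norm (Y \<omega>))\<^sup>2"
      by (rule sum_squares_bound)
    finally show ?thesis .
  qed
  moreover have "integrable M (\<lambda>\<omega>. (norm (X \<omega>))\<^sup>2 + (norm (Y \<omega>))\<^sup>2)"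
    using assms by (auto simp: square_integrable_def)
  moreover have "(\<lambda>\<omega>. X \<omega> \<bullet> Y \<omega>) \<in> borel_measurable M"
    using assms by (auto simp: square_integrable_def)
  ultimately show ?thesis
    by (auto elim!: Bochner_Integration.integrable_bound)
qed

lemma (in prob_space) integrable_square_integrable:
  fixes X :: "'a \<Rightarrow> real"
  assumes "square_integrable M X"
  shows "integrable M X"
proof -
  have "square_integrable M (\<lambda>_. 1 :: real)"
    by (simp add: square_integrable_def)
  from integrable_inner_square_integrable[OF assms this] show ?thesis
    by simp
qed

section \<open>The stochastic gradient process\<close>

text \<open>The batch sizes are arbitrary positive numbers here: the one-step inequality holds for
  all of them, and the power of k + 1 enters only in the final recursion.\<close>

locale sgd_process = prob_space M for M :: "'w measure" +
  fixes \<xi> :: "'w \<Rightarrow> real^'d"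
    and F :: "real^'m \<Rightarrow> real^'d \<Rightarrow> real"
    and f :: "real^'m \<Rightarrow> real"
    and x0 :: "'w \<Rightarrow> real^'m"
    and xs :: "real^'m"
    and L \<eta> \<nu> \<alpha> q :: real
    and N :: "nat \<Rightarrow> nat"
    and \<Xi> :: "nat \<Rightarrow> nat \<Rightarrow> 'w \<Rightarrow> real^'d"
  assumes F_measurable [measurable]: "case_prod F \<in> borel_measurable (borel \<Otimes>\<^sub>M borel)"
    and F_diff: "\<And>x z. (\<lambda>y. F y z) differentiable (at x)"
    and x0_measurable: "x0 \<in> borel_measurable M"
    and x0_square: "integrable M (\<lambda>\<omega>. (norm (x0 \<omega>))\<^sup>2)"
    and pos: "0 < L" "0 < \<eta>"
    and f_diff: "\<And>x. f differentiable (at x)"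
    and grad_continuous: "continuous_on UNIV (gradient f)"
    and grad_lipschitz: "\<And>x y. norm (gradient f x - gradient f y) \<le> L * norm (x - y)"
    and grad_monotone: "\<And>x y. (gradient f x - gradient f y) \<bullet> (x - y) \<ge> \<eta> * (norm (x - y))\<^sup>2"
    and minimizer: "\<And>y. f xs \<le> f y"
    and step_size: "0 < \<alpha>" "\<alpha> \<le> 2 / (\<eta> + L)"
    and q_def: "q = 1 - 2 * \<alpha> * \<eta> * L / (\<eta> + L)"
    and N_pos: "\<And>k. 0 < N k"
    and iid: "iid_samples M \<xi> x0 N \<Xi>"
    and oracle_noise: "unbiased_bounded_variance M f F \<nu> \<alpha> N \<Xi> x0"
begin

abbreviation iterate :: "nat \<Rightarrow> 'w \<Rightarrow> real^'m" where
  "iterate \<equiv> sgd f F \<alpha> N \<Xi> x0"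

abbreviation algebra :: "(nat \<times> nat) option set \<Rightarrow> 'w measure" where
  "algebra \<equiv> sample_algebra M x0 \<Xi>"

definition sampled_gradient :: "real^'m \<Rightarrow> real^'d \<Rightarrow> real^'m" where
  "sampled_gradient x z = gradient (\<lambda>y. F y z) x"

definition noise :: "nat \<Rightarrow> nat \<Rightarrow> 'w \<Rightarrow> real^'m" where
  "noise j k \<omega> = sampled_gradient (iterate k \<omega>) (\<Xi> j k \<omega>) - gradient f (iterate k \<omega>)"

definition error :: "nat \<Rightarrow> real" where
  "error = mean_sq_error M xs iterate"

text \<open>Nonnegativity is 4\<eta>L \<le> (\<eta> + L)^2 at the largest step size. The value 0
  occurs exactly for \<eta> = L with that step size.\<close>

lemma q_bounds: "0 \<le> q" "q < 1"
proof -
  have "\<alpha> * (2 * \<eta> * L / (\<eta> + L)) \<le> 2 / (\<eta> + L) * (2 * \<eta> * L / (\<eta> + L))"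
    using step_size pos by (intro mult_right_mono) auto
  also have "\<dots> = 4 * \<eta> * L / (\<eta> + L)\<^sup>2"
    by (simp add: power2_eq_square)
  also have "\<dots> \<le> 1"
    using pos sum_squares_bound[of \<eta> L] by (simp add: power2_sum divide_le_eq_1_pos add_pos_pos mult_ac)
  finally show "0 \<le> q"
    by (simp add: q_def mult_ac)
  show "q < 1"
    using pos step_size by (simp add: q_def)
qed

lemma borel_measurable_gradient_f [measurable]: "gradient f \<in> borel_measurable borel"
  using grad_continuous by (rule borel_measurable_continuous_onI)

lemma borel_measurable_sampled_gradient [measurable]:
  "case_prod sampled_gradient \<in> borel_measurable (borel \<Otimes>\<^sub>M borel)"
  using borel_measurable_gradient[OF F_measurable F_diff] unfolding sampled_gradient_def .

lemma sampling_error_eq: "sampling_error f F N \<Xi> k (iterate k \<omega>) \<omega> = (1 / real (N k)) *\<^sub>R (\<Sum>j=1..N k. noise j k \<omega>)"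
  using N_pos[of k]
  by (simp add: sampling_error_def noise_def sampled_gradient_def sum_subtractf scaleR_diff_right sum_constant_scaleR del: sum_constant)

lemma measurable_iterate: "iterate k \<in> borel_measurable (algebra (history_index N k))"
proof (induction k)
  case 0
  show ?case
    using measurable_initial_sample_algebra[of "history_index N 0" x0 M \<Xi>]
    by (simp add: history_index_def)
next
  case (Suc k)
  let ?A = "algebra (history_index N (Suc k))"
  have [measurable]: "iterate k \<in> borel_measurable ?A"
    using Suc.IH by (rule measurable_sample_algebra_mono[rotated]) (auto simp: history_index_def)
  have [measurable]: "\<Xi> j k \<in> borel_measurable ?A" if "j \<in> {1..N k}" for j
    using that by (intro measurable_sample_sample_algebra) (auto simp: history_index_def sample_index_def)
  have "(\<lambda>\<omega>. iterate k \<omega> - \<alpha> *\<^sub>R (gradient f (iterate k \<omega>) +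
      ((1 / real (N k)) *\<^sub>R (\<Sum>j=1..N k. sampled_gradient (iterate k \<omega>) (\<Xi> j k \<omega>)) - gradient f (iterate k \<omega>)))) \<in> borel_measurable ?A"
    by measurable
  then show ?case
    by (simp add: sampling_error_def sampled_gradient_def)
qed

lemma history_index_subset: "history_index N k \<subseteq> insert None (Some ` sample_index N)"
  by (auto simp: history_index_def)

lemmas subalgebra_algebra = subalgebra_sample_algebra[OF iid]

lemma borel_measurable_iterate [measurable]: "iterate k \<in> borel_measurable M"
  by (rule measurable_from_subalg[OF subalgebra_algebra[OF history_index_subset] measurable_iterate])

lemma borel_measurable_sample: "(j, k) \<in> sample_index N \<Longrightarrow> \<Xi> j k \<in> borel_measurable M"
  by (rule measurable_from_subalg[OF subalgebra_algebra[of "{Some (j, k)}"] measurable_sample_sample_algebra]) auto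

lemma measurable_noise:
  assumes "insert (Some (j, k)) (history_index N k) \<subseteq> J"
  shows "noise j k \<in> borel_measurable (algebra J)"
proof -
  have [measurable]: "iterate k \<in> borel_measurable (algebra J)"
    using assms by (intro measurable_sample_algebra_mono[OF _ measurable_iterate]) auto
  have [measurable]: "\<Xi> j k \<in> borel_measurable (algebra J)"
    using assms by (intro measurable_sample_sample_algebra) auto
  show ?thesis
    unfolding noise_def[abs_def] by measurable
qed

lemma borel_measurable_noise:
  assumes "(j, k) \<in> sample_index N"
  shows "noise j k \<in> borel_measurable M"
proof -
  have "insert (Some (j, k)) (history_index N k) \<subseteq> insert None (Some ` sample_index N)"
    using assms history_index_subset[of k] by simp
  then show ?thesis
    by (rule measurable_from_subalg[OF subalgebra_algebra measurable_noise[OF order_refl]])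
qed

text \<open>The conditional bound lives in \<open>ennreal\<close>, so it can be integrated before
  anything is known to be integrable; square integrability of the noise is then a
  consequence.\<close>

lemma noise_second_moment:
  assumes jk: "(j, k) \<in> sample_index N"
  shows "square_integrable M (noise j k)" "expectation (\<lambda>\<omega>. (norm (noise j k \<omega>))\<^sup>2) \<le> \<nu>\<^sup>2"
proof -
  note [measurable] = borel_measurable_noise[OF jk]
  interpret H: finite_measure_subalgebra M "history M x0 N \<Xi> k"
    unfolding history_eq_sample_algebra by unfold_locales (rule subalgebra_algebra[OF history_index_subset])
  have "(\<integral>\<^sup>+\<omega>. ennreal ((norm (noise j k \<omega>))\<^sup>2) \<partial>M)
      = (\<integral>\<^sup>+\<omega>. nn_cond_exp M (history M x0 N \<Xi> k) (\<lambda>\<omega>. ennreal ((norm (noise j k \<omega>))\<^sup>2)) \<omega> \<partial>M)"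
    using H.nn_cond_exp_intg[of "\<lambda>_. 1" "\<lambda>\<omega>. ennreal ((norm (noise j k \<omega>))\<^sup>2)"] by simp
  also have "\<dots> \<le> (\<integral>\<^sup>+\<omega>. ennreal (\<nu>\<^sup>2) \<partial>M)"
    using oracle_noise jk
    by (intro nn_integral_mono_AE)
      (auto simp: unbiased_bounded_variance_def noise_def sampled_gradient_def)
  also have "\<dots> = ennreal (\<nu>\<^sup>2)"
    by (simp add: emeasure_space_1)
  finally have le: "(\<integral>\<^sup>+\<omega>. ennreal ((norm (noise j k \<omega>))\<^sup>2) \<partial>M) \<le> ennreal (\<nu>\<^sup>2)" .
  then have int: "integrable M (\<lambda>\<omega>. (norm (noise j k \<omega>))\<^sup>2)"
    by (intro integrableI_nonneg) (auto intro: le_less_trans)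
  then show "square_integrable M (noise j k)"
    by (simp add: square_integrable_def)
  show "expectation (\<lambda>\<omega>. (norm (noise j k \<omega>))\<^sup>2) \<le> \<nu>\<^sup>2"
    using le int by (simp add: nn_integral_eq_integral)
qed

lemma square_integrable_gradient_iterate:
  assumes "square_integrable M (\<lambda>\<omega>. iterate k \<omega> - xs)"
  shows "square_integrable M (\<lambda>\<omega>. gradient f (iterate k \<omega>))"
  using assms
  by (rule square_integrable_bound[where c = L])
    (use grad_lipschitz[of _ xs] gradient_at_minimizer[OF f_diff minimizer] in auto)

text \<open>\<open>J\<close> may contain further samples, in particular others of the same batch;
  only sample (j, k) itself must be absent. This freedom is what makes the cross terms within a
  batch vanish.\<close>

lemma noise_orthogonal:
  assumes jk: "(j, k) \<in> sample_index N" and sq: "square_integrable M (\<lambda>\<omega>. iterate k \<omega> - xs)"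
    and J: "history_index N k \<subseteq> J" "J \<subseteq> insert None (Some ` sample_index N)" "Some (j, k) \<notin> J"
    and Y: "Y \<in> borel_measurable (algebra J)" "square_integrable M Y"
  shows "integrable M (\<lambda>\<omega>. Y \<omega> \<bullet> noise j k \<omega>)" "expectation (\<lambda>\<omega>. Y \<omega> \<bullet> noise j k \<omega>) = 0"
proof -
  note [measurable] = borel_measurable_noise[OF jk] borel_measurable_sample[OF jk]
  note noise_sq = noise_second_moment(1)[OF jk]
  show "integrable M (\<lambda>\<omega>. Y \<omega> \<bullet> noise j k \<omega>)"
    using Y noise_sq by (intro integrable_inner_square_integrable)
  have int_i: "integrable M (\<lambda>\<omega>. Y \<omega> $ i * noise j k \<omega> $ i)" for i
    using integrable_inner_square_integrable[OF square_integrable_vec_nth square_integrable_vec_nth, OF Y(2) noise_sq, of i i]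
    by simp
  \<comment> \<open>Coordinates are treated separately because \<open>vec_cond_exp\<close> is
    defined through scalar conditional expectations.\<close>
  have "expectation (\<lambda>\<omega>. Y \<omega> $ i * noise j k \<omega> $ i) = 0" for i
  proof -
    interpret H: finite_measure_subalgebra M "history M x0 N \<Xi> k"
      unfolding history_eq_sample_algebra by unfold_locales (rule subalgebra_algebra[OF history_index_subset])
    let ?\<gamma> = "\<lambda>(x, z). (sampled_gradient x z - gradient f x) $ i"
    let ?G = "\<lambda>\<omega>. sampled_gradient (iterate k \<omega>) (\<Xi> j k \<omega>) $ i"
    have noise: "?\<gamma> (iterate k \<omega>, \<Xi> j k \<omega>) = noise j k \<omega> $ i" for \<omega>
      by (simp add: noise_def)
    have int_noise: "integrable M (\<lambda>\<omega>. noise j k \<omega> $ i)"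
      by (rule integrable_square_integrable[OF square_integrable_vec_nth[OF noise_sq]])
    have int_grad: "integrable M (\<lambda>\<omega>. gradient f (iterate k \<omega>) $ i)"
      by (rule integrable_square_integrable[OF square_integrable_vec_nth[OF square_integrable_gradient_iterate[OF sq]]])
    have "expectation (\<lambda>\<omega>. Y \<omega> $ i * ?\<gamma> (iterate k \<omega>, \<Xi> j k \<omega>)) = 0"
    proof (rule indep_conditional_mean_zero)
      show "subalgebra M (algebra J)" "subalgebra M (algebra {Some (j, k)})"
        using J jk by (auto intro!: subalgebra_algebra)
      show "indep_set (sets (algebra J)) (sets (algebra {Some (j, k)}))"
        using J jk by (intro indep_sample_algebras[OF iid]) auto
      show "iterate k \<in> borel_measurable (algebra J)"
        by (rule measurable_sample_algebra_mono[OF J(1) measurable_iterate])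
      show "(\<lambda>\<omega>. Y \<omega> $ i) \<in> borel_measurable (algebra J)"
        by (rule measurable_compose[OF Y(1) borel_measurable_vec_nth])
      show "\<Xi> j k \<in> borel_measurable (algebra {Some (j, k)})"
        by (rule measurable_sample_sample_algebra) simp
      have "(\<lambda>(x, z). sampled_gradient x z - gradient f x) \<in> borel_measurable (borel \<Otimes>\<^sub>M borel)"
        by measurable
      from measurable_compose[OF this borel_measurable_vec_nth[of i]]
      show "?\<gamma> \<in> borel_measurable (borel \<Otimes>\<^sub>M borel)"
        by (simp add: case_prod_unfold)
      show "integrable M (\<lambda>\<omega>. ?\<gamma> (iterate k \<omega>, \<Xi> j k \<omega>))"
          "integrable M (\<lambda>\<omega>. Y \<omega> $ i * ?\<gamma> (iterate k \<omega>, \<Xi> j k \<omega>))"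
        unfolding noise by (rule int_noise int_i)+
      fix s :: "real^'m \<Rightarrow> real"
      assume s[measurable]: "s \<in> borel_measurable borel" and s1: "\<And>x. \<bar>s x\<bar> \<le> 1"
      have bounded: "integrable M (\<lambda>\<omega>. s (iterate k \<omega>) * X \<omega>)" if "integrable M X" for X :: "'w \<Rightarrow> real"
        using that s1 by (intro Bochner_Integration.integrable_bound[OF that])
          (auto simp: abs_mult mult_left_le_one_le)
      \<comment> \<open>Conditional expectation of the sampled gradient needs its integrability, not
        just that of the noise. This is where square integrability of the current iterate
        enters.\<close>
      have int_G: "integrable M ?G"
        using Bochner_Integration.integrable_add[OF int_noise int_grad] by (simp add: noise_def)
      have cond: "AE \<omega> in M. real_cond_exp M (history M x0 N \<Xi> k) ?G \<omega> = gradient f (iterate k \<omega>) $ i"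
        using oracle_noise jk
        by (auto simp: unbiased_bounded_variance_def vec_cond_exp_def vec_eq_iff sampled_gradient_def)
      have s_hist: "(\<lambda>\<omega>. s (iterate k \<omega>)) \<in> borel_measurable (history M x0 N \<Xi> k)"
        unfolding history_eq_sample_algebra using measurable_compose[OF measurable_iterate s] .
      \<comment> \<open>A bounded function of the iterate is measurable in the history, so it passes
        through the conditional expectation, and unbiasedness applies.\<close>
      have "expectation (\<lambda>\<omega>. s (iterate k \<omega>) * ?G \<omega>)
          = expectation (\<lambda>\<omega>. s (iterate k \<omega>) * real_cond_exp M (history M x0 N \<Xi> k) ?G \<omega>)"
        using H.real_cond_exp_intg(2)[OF bounded[OF int_G] s_hist borel_measurable_integrable[OF int_G]] by simp
      also have "\<dots> = expectation (\<lambda>\<omega>. s (iterate k \<omega>) * gradient f (iterate k \<omega>) $ i)"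
        using cond borel_measurable_integrable[OF bounded[OF int_grad]] by (intro integral_cong_AE) auto
      finally have "expectation (\<lambda>\<omega>. s (iterate k \<omega>) * ?G \<omega>) - expectation (\<lambda>\<omega>. s (iterate k \<omega>) * gradient f (iterate k \<omega>) $ i) = 0"
        by simp
      then show "expectation (\<lambda>\<omega>. s (iterate k \<omega>) * ?\<gamma> (iterate k \<omega>, \<Xi> j k \<omega>)) = 0"
        using bounded[OF int_G] bounded[OF int_grad]
        by (simp add: right_diff_distrib flip: Bochner_Integration.integral_diff)
    qed
    then show ?thesis
      unfolding noise .
  qed
  then show "expectation (\<lambda>\<omega>. Y \<omega> \<bullet> noise j k \<omega>) = 0"
    using int_i by (simp add: inner_vec_def Bochner_Integration.integral_sum)
qed

lemma mean_noise_second_moment: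
  assumes sq: "square_integrable M (\<lambda>\<omega>. iterate k \<omega> - xs)"
  shows "expectation (\<lambda>\<omega>. (norm ((1 / real (N k)) *\<^sub>R (\<Sum>j=1..N k. noise j k \<omega>)))\<^sup>2) \<le> \<nu>\<^sup>2 / real (N k)"
proof -
  have idx: "(j, k) \<in> sample_index N" if "j \<in> {1..N k}" for j
    using that by (simp add: sample_index_def)
  have cross: "integrable M (\<lambda>\<omega>. noise i k \<omega> \<bullet> noise j k \<omega>) \<and>
      expectation (\<lambda>\<omega>. noise i k \<omega> \<bullet> noise j k \<omega>) \<le> (if i = j then \<nu>\<^sup>2 else 0)"
    if ij: "i \<in> {1..N k}" "j \<in> {1..N k}" for i j
  proof (cases "i = j")
    case True
    then show ?thesis
      using noise_second_moment[OF idx[OF ij(2)]]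
      by (auto simp: square_integrable_def simp flip: power2_norm_eq_inner)
  next
    case False
    \<comment> \<open>The history enlarged by sample i makes \<open>noise i k\<close> admissible as
      test vector while sample j stays fresh.\<close>
    let ?J = "insert (Some (i, k)) (history_index N k)"
    have "Some (j, k) \<notin> ?J" "?J \<subseteq> insert None (Some ` sample_index N)"
      using False idx[OF ij(1)] by (auto simp: history_index_def)
    then show ?thesis
      using noise_orthogonal[where J = ?J and Y = "noise i k", OF idx[OF ij(2)] sq subset_insertI] False
        measurable_noise[of i k ?J] noise_second_moment[OF idx[OF ij(1)]]
      by auto
  qed
  have "expectation (\<lambda>\<omega>. (norm (\<Sum>j=1..N k. noise j k \<omega>))\<^sup>2)
      = expectation (\<lambda>\<omega>. \<Sum>i=1..N k. \<Sum>j=1..N k. noise i k \<omega> \<bullet> noise j k \<omega>)"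
    by (simp only: power2_norm_eq_inner inner_sum_left) (simp only: inner_sum_right)
  also have "\<dots> = (\<Sum>i=1..N k. \<Sum>j=1..N k. expectation (\<lambda>\<omega>. noise i k \<omega> \<bullet> noise j k \<omega>))"
    using cross by (subst Bochner_Integration.integral_sum; (intro sum.cong Bochner_Integration.integral_sum Bochner_Integration.integrable_sum refl)?) auto
  also have "\<dots> \<le> (\<Sum>i=1..N k. \<Sum>j=1..N k. if i = j then \<nu>\<^sup>2 else 0)"
    using cross by (intro sum_mono) auto
  also have "\<dots> = real (N k) * \<nu>\<^sup>2"
    by simp
  finally have "expectation (\<lambda>\<omega>. (norm (\<Sum>j=1..N k. noise j k \<omega>))\<^sup>2) / (real (N k))\<^sup>2 \<le> real (N k) * \<nu>\<^sup>2 / (real (N k))\<^sup>2"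
    by (rule divide_right_mono) simp
  then show ?thesis
    using N_pos[of k] by (simp add: power_mult_distrib power_divide power2_eq_square)
qed

text \<open>Integrability travels along with the estimate: orthogonality presupposes a
  square-integrable iterate, and a Bochner integral without integrability would default to 0 and
  make \<open>error\<close> meaningless.\<close>

lemma iterate_step:
  assumes sq: "square_integrable M (\<lambda>\<omega>. iterate k \<omega> - xs)"
  shows "square_integrable M (\<lambda>\<omega>. iterate (Suc k) \<omega> - xs)"
    and "error (Suc k) \<le> q * error k + \<alpha>\<^sup>2 * \<nu>\<^sup>2 / real (N k)"
proof -
  define u where "u \<omega> = iterate k \<omega> - \<alpha> *\<^sub>R gradient f (iterate k \<omega>) - xs" for \<omega>
  define w where "w \<omega> = (1 / real (N k)) *\<^sub>R (\<Sum>j=1..N k. noise j k \<omega>)" for \<omega>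
  have idx: "(j, k) \<in> sample_index N" if "j \<in> {1..N k}" for j
    using that by (simp add: sample_index_def)
  have step: "iterate (Suc k) \<omega> - xs = u \<omega> - \<alpha> *\<^sub>R w \<omega>" for \<omega>
    by (simp add: u_def w_def sampling_error_eq algebra_simps)
  have u_sq: "square_integrable M u"
    using square_integrable_diff[OF sq square_integrable_scaleR[OF square_integrable_gradient_iterate[OF sq], of \<alpha>]]
    by (simp add: u_def[abs_def] algebra_simps)
  have w_sq: "square_integrable M w"
    unfolding w_def[abs_def]
    by (intro square_integrable_scaleR square_integrable_sum noise_second_moment idx)
  show "square_integrable M (\<lambda>\<omega>. iterate (Suc k) \<omega> - xs)"
    unfolding step by (intro square_integrable_diff square_integrable_scaleR u_sq w_sq)
  have [measurable]: "iterate k \<in> borel_measurable (algebra (history_index N k))"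
    by (rule measurable_iterate)
  have "u \<in> borel_measurable (algebra (history_index N k))"
    unfolding u_def[abs_def] by measurable
  then have orth: "integrable M (\<lambda>\<omega>. u \<omega> \<bullet> noise j k \<omega>)" "expectation (\<lambda>\<omega>. u \<omega> \<bullet> noise j k \<omega>) = 0"
    if "j \<in> {1..N k}" for j
    using noise_orthogonal[OF idx[OF that] sq order_refl history_index_subset _ _ u_sq]
    by (auto simp: history_index_def)
  have "expectation (\<lambda>\<omega>. u \<omega> \<bullet> w \<omega>) = (1 / real (N k)) * (\<Sum>j=1..N k. expectation (\<lambda>\<omega>. u \<omega> \<bullet> noise j k \<omega>))"
    unfolding w_def using orth(1)
    by (simp add: inner_sum_right Bochner_Integration.integral_sum)
  then have uw: "expectation (\<lambda>\<omega>. u \<omega> \<bullet> w \<omega>) = 0"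
    using orth(2) by simp
  have int: "integrable M (\<lambda>\<omega>. (norm (u \<omega>))\<^sup>2)" "integrable M (\<lambda>\<omega>. (norm (w \<omega>))\<^sup>2)"
      "integrable M (\<lambda>\<omega>. u \<omega> \<bullet> w \<omega>)" "integrable M (\<lambda>\<omega>. (norm (iterate k \<omega> - xs))\<^sup>2)"
    using u_sq w_sq sq integrable_inner_square_integrable[OF u_sq w_sq] by (auto simp: square_integrable_def)
  have "error (Suc k) = expectation (\<lambda>\<omega>. (norm (u \<omega>))\<^sup>2 - 2 * \<alpha> * (u \<omega> \<bullet> w \<omega>) + \<alpha>\<^sup>2 * (norm (w \<omega>))\<^sup>2)"
    unfolding error_def mean_sq_error_def step
    unfolding power2_norm_eq_inner
    by (intro Bochner_Integration.integral_cong refl)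
      (simp add: inner_diff_left inner_diff_right inner_commute power2_eq_square[of \<alpha>] algebra_simps)
  also have "\<dots> = expectation (\<lambda>\<omega>. (norm (u \<omega>))\<^sup>2) + \<alpha>\<^sup>2 * expectation (\<lambda>\<omega>. (norm (w \<omega>))\<^sup>2)"
    using int uw by simp
  also have "\<dots> \<le> expectation (\<lambda>\<omega>. q * (norm (iterate k \<omega> - xs))\<^sup>2) + \<alpha>\<^sup>2 * (\<nu>\<^sup>2 / real (N k))"
  proof (intro add_mono mult_left_mono integral_mono)
    show "(norm (u \<omega>))\<^sup>2 \<le> q * (norm (iterate k \<omega> - xs))\<^sup>2" for \<omega>
      unfolding u_def q_def
      by (rule gradient_step_contraction[OF f_diff grad_lipschitz grad_monotone minimizer pos(2,1) step_size])
    show "expectation (\<lambda>\<omega>. (norm (w \<omega>))\<^sup>2) \<le> \<nu>\<^sup>2 / real (N k)"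
      unfolding w_def by (rule mean_noise_second_moment[OF sq])
  qed (use int in auto)
  also have "\<dots> = q * error k + \<alpha>\<^sup>2 * \<nu>\<^sup>2 / real (N k)"
    by (simp add: error_def mean_sq_error_def)
  finally show "error (Suc k) \<le> q * error k + \<alpha>\<^sup>2 * \<nu>\<^sup>2 / real (N k)" .
qed

lemma square_integrable_iterate: "square_integrable M (\<lambda>\<omega>. iterate k \<omega> - xs)"
proof (induction k)
  case 0
  have "square_integrable M x0" "square_integrable M (\<lambda>_. xs)"
    using x0_measurable x0_square by (auto simp: square_integrable_def)
  then show ?case
    using square_integrable_diff by simp
qed (rule iterate_step)

lemma error_recursion:
  assumes N: "\<And>k. (real k + 1) powr v \<le> real (N k)"
  shows "error (Suc k) \<le> q * error k + \<alpha>\<^sup>2 * \<nu>\<^sup>2 * real (Suc k) powr (- v)"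
proof -
  have "\<alpha>\<^sup>2 * \<nu>\<^sup>2 / real (N k) \<le> \<alpha>\<^sup>2 * \<nu>\<^sup>2 / (real (Suc k) powr v)"
    using N[of k] N_pos[of k] by (intro divide_left_mono) (auto simp: add.commute)
  then show ?thesis
    using iterate_step(2)[OF square_integrable_iterate, of k] by (simp add: powr_minus divide_inverse)
qed

end

text \<open>\<open>B\<close> is chosen before v, so the O-constants are uniform over v \<ge> v0,
  while the range of small \<epsilon> may depend on v. The constant obtained blows up as v0 tends to
  0.\<close>

theorem proposition5:
  fixes M :: "'w measure"
    and \<xi> :: "'w \<Rightarrow> real^'d"
    and F :: "real^'m \<Rightarrow> real^'d \<Rightarrow> real"
    and f :: "real^'m \<Rightarrow> real"
    and x0 :: "'w \<Rightarrow> real^'m"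
    and xs :: "real^'m"
    and L \<eta> \<nu> \<alpha> q :: real
  assumes "prob_space M"
    and "\<xi> \<in> borel_measurable M"
    and "case_prod F \<in> borel_measurable (borel \<Otimes>\<^sub>M borel)"
    and "\<And>x z. (\<lambda>y. F y z) differentiable (at x)"
    and "\<And>x. integrable M (\<lambda>\<omega>. F x (\<xi> \<omega>))"
    and "\<And>x. f x = (\<integral>\<omega>. F x (\<xi> \<omega>) \<partial>M)"
    and "x0 \<in> borel_measurable M"
    and "integrable M (\<lambda>\<omega>. (norm (x0 \<omega>))\<^sup>2)"
    and "L > 0" and "\<eta> > 0" and "\<nu> > 0"
    and "\<And>x. f differentiable (at x)"
    and "continuous_on UNIV (gradient f)"
    and "\<And>x y. norm (gradient f x - gradient f y) \<le> L * norm (x - y)"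
    and "\<And>x y. (gradient f x - gradient f y) \<bullet> (x - y) \<ge> \<eta> * (norm (x - y))\<^sup>2"
    and "\<And>y. f xs \<le> f y"
    and "0 < \<alpha>" and "\<alpha> \<le> 2 / (\<eta> + L)"
    and "q = 1 - 2 * \<alpha> * \<eta> * L / (\<eta> + L)"
  shows
    "(\<forall>v>0. \<forall>\<Xi> :: nat \<Rightarrow> nat \<Rightarrow> 'w \<Rightarrow> real^'d.
        iid_samples M \<xi> x0 (batch_size v) \<Xi> \<longrightarrow>
        unbiased_bounded_variance M f F \<nu> \<alpha> (batch_size v) \<Xi> x0 \<longrightarrow>
        (let x = sgd f F \<alpha> (batch_size v) \<Xi> x0 in
          (\<forall>k. integrable M (\<lambda>\<omega>. (norm (x k \<omega> - xs))\<^sup>2)) \<and>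
          (q > 0 \<longrightarrow> (\<forall>k\<ge>1. mean_sq_error M xs x k
              \<le> C_const q \<alpha> \<nu> (mean_sq_error M xs x 0) v * real k powr (- v))) \<and>
          (\<forall>\<epsilon>>0. \<exists>K. mean_sq_error M xs x K \<le> \<epsilon>)))
     \<and>
     (\<forall>v0>0. \<exists>B. \<forall>v\<ge>v0. \<forall>\<Xi> :: nat \<Rightarrow> nat \<Rightarrow> 'w \<Rightarrow> real^'d.
        iid_samples M \<xi> x0 (batch_size v) \<Xi> \<longrightarrow>
        unbiased_bounded_variance M f F \<nu> \<alpha> (batch_size v) \<Xi> x0 \<longrightarrow>
        (let x = sgd f F \<alpha> (batch_size v) \<Xi> x0 in
          \<forall>\<^sub>F \<epsilon> in at_right 0.
            real (iterations_required M xs x \<epsilon>) \<le> B * (v * (1 / \<epsilon>) powr (1 / v)) \<and>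
            real (gradients_required M xs x (batch_size v) \<epsilon>)
              \<le> B * (exp v * v powr v * (1 / \<epsilon>) powr (1 + 1 / v))))"
proof -
  have process: "sgd_process M \<xi> F f x0 xs L \<eta> \<nu> \<alpha> q (batch_size v) \<Xi>"
    if "iid_samples M \<xi> x0 (batch_size v) \<Xi>" "unbiased_bounded_variance M f F \<nu> \<alpha> (batch_size v) \<Xi> x0" for v \<Xi>
    using assms that batch_size_pos by (intro sgd_process.intro sgd_process_axioms.intro) auto
  \<comment> \<open>Unlike \<open>C_const\<close>, this constant does not involve v; it is therefore
    the one that feeds the uniform complexity bounds.\<close>
  define D where "D = \<alpha>\<^sup>2 * \<nu>\<^sup>2 / (1 - sqrt q) + 1"
  have rate: "\<forall>\<^sub>F k in sequentially. mean_sq_error M xs (sgd f F \<alpha> (batch_size v) \<Xi> x0) k \<le> D * real k powr (- v)"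
    if "0 < v" and "sgd_process M \<xi> F f x0 xs L \<eta> \<nu> \<alpha> q (batch_size v) \<Xi>" for v \<Xi>
  proof -
    interpret sgd_process M \<xi> F f x0 xs L \<eta> \<nu> \<alpha> q "batch_size v" \<Xi> by fact
    show ?thesis
      using contraction_recursion_asymptotics[OF q_bounds \<open>0 < v\<close> _ error_recursion[OF batch_size_ge]]
      by (simp add: D_def error_def)
  qed
  show ?thesis
  proof (intro conjI allI impI)
    fix v :: real and \<Xi> :: "nat \<Rightarrow> nat \<Rightarrow> 'w \<Rightarrow> real^'d"
    assume v: "0 < v" and "iid_samples M \<xi> x0 (batch_size v) \<Xi>"
      and "unbiased_bounded_variance M f F \<nu> \<alpha> (batch_size v) \<Xi> x0"
    then interpret sgd_process M \<xi> F f x0 xs L \<eta> \<nu> \<alpha> q "batch_size v" \<Xi>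
      by (intro process)
    have "integrable M (\<lambda>\<omega>. (norm (iterate k \<omega> - xs))\<^sup>2)" for k
      using square_integrable_iterate[of k] by (simp add: square_integrable_def)
    moreover have "mean_sq_error M xs iterate k \<le> C_const q \<alpha> \<nu> (mean_sq_error M xs iterate 0) v * real k powr (- v)"
      if "0 < q" "1 \<le> k" for k
      using contraction_recursion_C_const[OF \<open>0 < q\<close> q_bounds(2) v \<open>1 \<le> k\<close> _ error_recursion[OF batch_size_ge]]
      by (simp add: error_def mean_sq_error_def)
    \<comment> \<open>This guarantees that the \<open>LEAST\<close> in
      \<open>iterations_required\<close> is attained.\<close>
    moreover have "\<exists>K. mean_sq_error M xs iterate K \<le> \<epsilon>" if "0 < \<epsilon>" for \<epsilon>
    proof -
      have "((\<lambda>x::real. D * x powr (- v)) \<longlongrightarrow> 0) at_top"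
        using v by real_asymp
      then have "(\<lambda>k. D * real k powr (- v)) \<longlonglongrightarrow> 0"
        by (rule filterlim_compose) (rule filterlim_real_sequentially)
      then have "\<forall>\<^sub>F k in sequentially. D * real k powr (- v) < \<epsilon>"
        using \<open>0 < \<epsilon>\<close> by (rule order_tendstoD)
      with rate[OF v sgd_process_axioms] have "\<forall>\<^sub>F k in sequentially. mean_sq_error M xs iterate k \<le> \<epsilon>"
        by eventually_elim simp
      then show ?thesis
        by (auto simp: eventually_sequentially)
    qed
    ultimately show "let x = iterate in
          (\<forall>k. integrable M (\<lambda>\<omega>. (norm (x k \<omega> - xs))\<^sup>2)) \<and>
          (q > 0 \<longrightarrow> (\<forall>k\<ge>1. mean_sq_error M xs x k
              \<le> C_const q \<alpha> \<nu> (mean_sq_error M xs x 0) v * real k powr (- v))) \<and>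
          (\<forall>\<epsilon>>0. \<exists>K. mean_sq_error M xs x K \<le> \<epsilon>)"
      by (simp add: Let_def)
  next
    fix v0 :: real assume v0: "0 < v0"
    show "\<exists>B. \<forall>v\<ge>v0. \<forall>\<Xi> :: nat \<Rightarrow> nat \<Rightarrow> 'w \<Rightarrow> real^'d.
        iid_samples M \<xi> x0 (batch_size v) \<Xi> \<longrightarrow>
        unbiased_bounded_variance M f F \<nu> \<alpha> (batch_size v) \<Xi> x0 \<longrightarrow>
        (let x = sgd f F \<alpha> (batch_size v) \<Xi> x0 in
          \<forall>\<^sub>F \<epsilon> in at_right 0.
            real (iterations_required M xs x \<epsilon>) \<le> B * (v * (1 / \<epsilon>) powr (1 / v)) \<and>
            real (gradients_required M xs x (batch_size v) \<epsilon>)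
              \<le> B * (exp v * v powr v * (1 / \<epsilon>) powr (1 + 1 / v)))"
    proof (intro exI allI impI)
      fix v :: real and \<Xi> :: "nat \<Rightarrow> nat \<Rightarrow> 'w \<Rightarrow> real^'d"
      assume v: "v0 \<le> v" and "iid_samples M \<xi> x0 (batch_size v) \<Xi>"
        and "unbiased_bounded_variance M f F \<nu> \<alpha> (batch_size v) \<Xi> x0"
      then interpret sgd_process M \<xi> F f x0 xs L \<eta> \<nu> \<alpha> q "batch_size v" \<Xi>
        by (intro process)
      have "1 \<le> D"
        using q_bounds by (simp add: D_def)
      from complexity_of_polynomial_rate[OF this v0 v rate[OF _ sgd_process_axioms]] v v0
      show "let x = iterate in
          \<forall>\<^sub>F \<epsilon> in at_right 0.
            real (iterations_required M xs x \<epsilon>)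
              \<le> max (2 / v0 * D powr (1 / v0)) (4 * exp 1 * D powr (1 + 1 / v0)) * (v * (1 / \<epsilon>) powr (1 / v)) \<and>
            real (gradients_required M xs x (batch_size v) \<epsilon>)
              \<le> max (2 / v0 * D powr (1 / v0)) (4 * exp 1 * D powr (1 + 1 / v0)) * (exp v * v powr v * (1 / \<epsilon>) powr (1 + 1 / v))"
        by (simp add: Let_def iterations_required_def gradients_required_def)
    qed
  qed
qed

end
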